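(* There are families of $n$-vertex strongly hyperbolic uniform disk graphs (each family containing graphs with arbitrarily large $n$) with disk radius in $\Theta(\log n)$ and (i) clique number in $O(\log\log n)$ and treewidth in $\Omega(\log n)$; (ii) clique number in $O(1)$ and treewidth in $\Omega(\log\log n)$. That is, there is one such family satisfying (i), and one such family satisfying (ii).
   Context: Graphs are finite and simple. For $r>0$, a graph $G$ is a hyperbolic uniform disk graph (HUDG) with disk radius $r$ if its vertices can be assigned to points of the hyperbolic plane (of curvature $-1$) such that two distinct vertices are adjacent if and only if their points have hyperbolic distance at most $2r$ (i.e. $G$ is the intersection graph of closed disks of radius $r$). $G$ is a strongly hyperbolic uniform disk graph (SHUDG) with disk radius $r$ if moreover the points can be chosen such that all of them have distance at most $2r$ from a fixed point (the origin). The clique number is the number of vertices of a largest complete subgraph. Asymptotics are with respect to the number $n$ of vertices: a family of SHUDGs has disk radius in $\Theta(r(n))$ if there are constants $c_1,c_2>0$ such that every sufficiently large $n$-vertex graph $G$ of the family is, for some $r_G$ satisfying $c_1r(n)\le r_G\le c_2r(n)$, a SHUDG with disk radius $r_G$ (i.e. the vertices of $G$ can be assigned to points of the hyperbolic plane, all at distance at most $2r_G$ from the origin, such that two distinct vertices are adjacent if and only if their points have hyperbolic distance at most $2r_G$); the asymptotic statements about clique number and treewidth are understood analogously. *)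

theory Defs
  imports "Graph_Theory.Kuratowski" "HOL-Library.Landau_Symbols"
begin

text \<open>
  A finite simple graph is a \<^const>\<open>pair_graph\<close>, i.e. a finite, symmetric, loop-free
  \<^typ>\<open>'a pair_pre_digraph\<close>; every undirected edge is present as two opposite arcs.
\<close>

subsection \<open>Clique number and treewidth\<close>

definition clique_number :: "'a pair_pre_digraph \<Rightarrow> nat" where
  "clique_number G = Max {k. \<exists>H. subgraph H (with_proj G) \<and> complete_digraph k H}"

text \<open>
  The constant \<^const>\<open>tree\<close> of the library asks for the absence of \<^emph>\<open>directed\<close> cycles. In a
  symmetric digraph traversing an edge back and forth is such a cycle (of length 2), so cycles
  of an undirected graph are those of length at least 3. Connected graphs are non-empty.
\<close>

definition undirected_tree :: "'a pair_pre_digraph \<Rightarrow> bool" where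
  "undirected_tree T \<longleftrightarrow>
     pair_graph T \<and> connected (with_proj T) \<and>
     \<not> (\<exists>p. pre_digraph.cycle (with_proj T) p \<and> length p \<ge> 3)"

definition tree_decomposition ::
  "'a pair_pre_digraph \<Rightarrow> 't pair_pre_digraph \<Rightarrow> ('t \<Rightarrow> 'a set) \<Rightarrow> bool" where
  "tree_decomposition G T B \<longleftrightarrow>
     undirected_tree T \<and>
     (\<Union>t\<in>pverts T. B t) = pverts G \<and>
     (\<forall>u v. (u, v) \<in> parcs G \<longrightarrow> (\<exists>t\<in>pverts T. u \<in> B t \<and> v \<in> B t)) \<and>
     (\<forall>v\<in>pverts G. connected (with_proj T \<restriction> {t \<in> pverts T. v \<in> B t}))"

text \<open>
  The subtraction truncates only if all bags are empty, that is, for the graph without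
  vertices. Since decomposition trees are finite, it is no restriction that their nodes are
  natural numbers in the definition of the treewidth.
\<close>

definition decomposition_width :: "'t pair_pre_digraph \<Rightarrow> ('t \<Rightarrow> 'a set) \<Rightarrow> nat" where
  "decomposition_width T B = Max ((\<lambda>t. card (B t)) ` pverts T) - 1"

definition treewidth :: "'a pair_pre_digraph \<Rightarrow> nat" where
  "treewidth G =
     Inf {decomposition_width T B | (T :: nat pair_pre_digraph) B. tree_decomposition G T B}"


subsection \<open>Strongly hyperbolic uniform disk graphs\<close>

text \<open>
  The hyperbolic plane of curvature \<open>-1\<close> in the Poincare disk model, with origin \<open>0\<close>. Lemma
  \<open>hyp_dist_polar\<close> below is the hyperbolic law of cosines.
\<close>

definition hyp_plane :: "complex set" where
  "hyp_plane = {z. cmod z < 1}"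

definition hyp_dist :: "complex \<Rightarrow> complex \<Rightarrow> real" where
  "hyp_dist z w =
     arcosh (1 + 2 * (cmod (z - w))\<^sup>2 / ((1 - (cmod z)\<^sup>2) * (1 - (cmod w)\<^sup>2)))"

lemma hyp_dist_polar:
  fixes a b \<alpha> \<beta> :: real
  shows "hyp_dist (rcis (tanh (a / 2)) \<alpha>) (rcis (tanh (b / 2)) \<beta>) =
           arcosh (cosh a * cosh b - sinh a * sinh b * cos (\<alpha> - \<beta>))"
proof -
  define s where "s = tanh (a / 2)"
  define t where "t = tanh (b / 2)"
  define c where "c = cos (\<alpha> - \<beta>)"
  have half: "1 - (tanh (x / 2))\<^sup>2 > 0 \<and>
      cosh x = (1 + (tanh (x / 2))\<^sup>2) / (1 - (tanh (x / 2))\<^sup>2) \<and>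
      sinh x = 2 * tanh (x / 2) / (1 - (tanh (x / 2))\<^sup>2)" for x :: real
  proof -
    have ch: "cosh (x / 2) \<noteq> 0" "cosh (x / 2) > 0"
      using cosh_real_pos[of "x / 2"] by simp_all
    have sq: "(sinh (x / 2))\<^sup>2 = (cosh (x / 2))\<^sup>2 - 1"
      by (simp add: cosh_square_eq)
    have t1: "1 - (tanh (x / 2))\<^sup>2 = 1 / (cosh (x / 2))\<^sup>2"
      using ch sq by (simp add: tanh_def power_divide field_simps)
    have "cosh x = (cosh (x / 2))\<^sup>2 + (sinh (x / 2))\<^sup>2"
      using cosh_add[of "x / 2" "x / 2"] by (simp add: power2_eq_square)
    also have "\<dots> = (1 + (tanh (x / 2))\<^sup>2) * (cosh (x / 2))\<^sup>2"
      using ch by (simp add: tanh_def power_divide field_simps)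
    finally have c1: "cosh x = (1 + (tanh (x / 2))\<^sup>2) / (1 - (tanh (x / 2))\<^sup>2)"
      unfolding t1 by simp
    have "sinh x = 2 * sinh (x / 2) * cosh (x / 2)"
      using sinh_add[of "x / 2" "x / 2"] by simp
    also have "\<dots> = 2 * tanh (x / 2) * (cosh (x / 2))\<^sup>2"
      using ch by (simp add: tanh_def power2_eq_square)
    finally have "sinh x = 2 * tanh (x / 2) / (1 - (tanh (x / 2))\<^sup>2)"
      unfolding t1 by simp
    with c1 t1 ch show ?thesis by simp
  qed
  have "(cmod (rcis s \<alpha> - rcis t \<beta>))\<^sup>2 =
      (s * cos \<alpha> - t * cos \<beta>)\<^sup>2 + (s * sin \<alpha> - t * sin \<beta>)\<^sup>2"
    by (simp add: cmod_power2)
  also have "\<dots> = s\<^sup>2 * ((sin \<alpha>)\<^sup>2 + (cos \<alpha>)\<^sup>2) + t\<^sup>2 * ((sin \<beta>)\<^sup>2 + (cos \<beta>)\<^sup>2) - 2 * s * t * c"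
    unfolding c_def cos_diff by algebra
  finally have norm: "(cmod (rcis s \<alpha> - rcis t \<beta>))\<^sup>2 = s\<^sup>2 + t\<^sup>2 - 2 * s * t * c"
    by simp
  have pos: "1 - s\<^sup>2 > 0" "1 - t\<^sup>2 > 0"
    using half[of a] half[of b] by (simp_all add: s_def t_def)
  have "1 + 2 * (s\<^sup>2 + t\<^sup>2 - 2 * s * t * c) / ((1 - s\<^sup>2) * (1 - t\<^sup>2)) =
      ((1 + s\<^sup>2) * (1 + t\<^sup>2) - 2 * s * (2 * t) * c) / ((1 - s\<^sup>2) * (1 - t\<^sup>2))"
  proof -
    have "(1 - s\<^sup>2) * (1 - t\<^sup>2) \<noteq> 0"
      using pos by simp
    then show ?thesis
      by (simp add: add_divide_eq_iff) (simp add: algebra_simps)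
  qed
  also have "\<dots> = (1 + s\<^sup>2) / (1 - s\<^sup>2) * ((1 + t\<^sup>2) / (1 - t\<^sup>2)) -
      2 * s / (1 - s\<^sup>2) * (2 * t / (1 - t\<^sup>2)) * c"
    by (simp add: diff_divide_distrib)
  also have "\<dots> = cosh a * cosh b - sinh a * sinh b * c"
    using half[of a] half[of b] unfolding s_def t_def by simp
  finally show ?thesis
    using norm by (simp add: hyp_dist_def c_def flip: s_def t_def)
qed

definition shudg :: "real \<Rightarrow> 'a pair_pre_digraph \<Rightarrow> bool" where
  "shudg r G \<longleftrightarrow>
     pair_graph G \<and> r > 0 \<and>
     (\<exists>\<phi>. (\<forall>v\<in>pverts G. \<phi> v \<in> hyp_plane \<and> hyp_dist 0 (\<phi> v) \<le> 2 * r) \<and>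
          (\<forall>u\<in>pverts G. \<forall>v\<in>pverts G. u \<noteq> v \<longrightarrow>
             ((u, v) \<in> parcs G \<longleftrightarrow> hyp_dist (\<phi> u) (\<phi> v) \<le> 2 * r)))"


subsection \<open>Asymptotics in families of graphs\<close>

definition shudg_family :: "'a pair_pre_digraph set \<Rightarrow> bool" where
  "shudg_family \<G> \<longleftrightarrow>
     (\<forall>G\<in>\<G>. \<exists>r. shudg r G) \<and> (\<forall>N. \<exists>G\<in>\<G>. card (pverts G) \<ge> N)"

text \<open>The graphs of a family, as their number of vertices tends to infinity.\<close>

definition order_at_top :: "'a pair_pre_digraph set \<Rightarrow> 'a pair_pre_digraph filter" where
  "order_at_top \<G> = inf (filtercomap (\<lambda>G. card (pverts G)) at_top) (principal \<G>)"

lemma eventually_order_at_top: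
  "eventually P (order_at_top \<G>) \<longleftrightarrow> (\<exists>N. \<forall>G\<in>\<G>. card (pverts G) \<ge> N \<longrightarrow> P G)"
  unfolding order_at_top_def eventually_inf_principal eventually_filtercomap
    eventually_at_top_linorder
  by (metis (mono_tags, lifting))

definition disk_radius_bigtheta :: "'a pair_pre_digraph set \<Rightarrow> (nat \<Rightarrow> real) \<Rightarrow> bool" where
  "disk_radius_bigtheta \<G> f \<longleftrightarrow>
     (\<exists>c1>0. \<exists>c2>0. \<forall>\<^sub>F G in order_at_top \<G>.
        \<exists>r. c1 * f (card (pverts G)) \<le> r \<and> r \<le> c2 * f (card (pverts G)) \<and> shudg r G)"

end

theory Submission
  imports Defs "HOL-Computational_Algebra.Primes"
begin

text \<open>
  Both families come from one construction. In the upper half-plane, scaled horizontally by the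
  right factor, disks of equal large radius at points of abscissae \<open>x, x'\<close> and heights \<open>y, y'\<close>
  intersect essentially when \<open>(x - x')\<^sup>2 \<le> y * y'\<close>. The points are put on levels: on level \<open>j\<close>
  they have height \<open>2 * 4 ^ j\<close> and abscissae the odd multiples of \<open>4 ^ j\<close>, so that points of
  levels \<open>i\<close> and \<open>j\<close> are adjacent iff \<open>\<bar>x - x'\<bar> \<le> 2 * 2 ^ (i + j)\<close>. For a finite set \<open>L\<close> of levels
  with maximum \<open>h\<close> the abscissae range up to \<open>2 * card L * 4 ^ h\<close>, which leaves exactly \<open>card L\<close>
  points on the top level.

  Treewidth: each level is a path (a row), and the points whose abscissa lies in one of the
  \<open>card L\<close> intervals of length \<open>2 * 4 ^ h\<close> form a connected set (a column), held together by its
  point on the top level. Every row meets every column, so the unions of a row and a column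
  form a bramble of order \<open>card L\<close>. By the Helly property of subtrees (\<open>subtrees_Helly\<close>) some
  bag meets all of these unions, hence all rows or all columns, and the treewidth is at least
  \<open>card L - 1\<close> (\<open>treewidth_level_graph_ge\<close>).

  Cliques: a clique has at most two points on each level. If a point of level \<open>i\<close> is adjacent
  to points of two higher levels \<open>j < l\<close>, then these two points are close to each other; but
  an odd multiple of \<open>4 ^ j\<close> and a multiple of \<open>4 ^ l\<close> differ by at least \<open>4 ^ j\<close>, and this forces
  \<open>2 * j \<le> i + l + 1\<close>. So, up to an offset of one, the heights of the levels of a clique
  above its lowest level at least double from one to the next
  (\<open>clique_number_level_graph_le\<close>).

  It remains to choose the levels. With \<open>L = {0..h}\<close> there are \<open>h + 1\<close> of them, and doubling gaps
  allow \<open>O(log h)\<close> levels in a clique. With \<open>L = {2 ^ s - 2 ^ t | t \<le> s}\<close> the gaps shrink by half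
  on the way up, so doubling gaps allow at most three levels, while there are still
  \<open>s + 1\<close> of them, the largest being \<open>h = 2 ^ s - 1\<close>. In both cases \<open>ln n\<close> and the disk radius are of order \<open>h\<close>.
\<close>

section \<open>Subtrees of a tree\<close>

text \<open>
  Connectedness of a vertex set in the subgraph that it induces, expressed by the closure
  \<open>rtrancl_on\<close>, which also underlies reachability in digraphs.
\<close>
definition walk_connected :: "'a rel \<Rightarrow> 'a set \<Rightarrow> bool" where
  "walk_connected r S \<longleftrightarrow> (\<forall>a\<in>S. \<forall>b\<in>S. (a, b) \<in> rtrancl_on S r)"

lemma walk_connectedD: "walk_connected r S \<Longrightarrow> a \<in> S \<Longrightarrow> b \<in> S \<Longrightarrow> (a, b) \<in> rtrancl_on S r"
  by (simp add: walk_connected_def)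

lemma walk_connected_Un:
  assumes "walk_connected r S" "walk_connected r T" "S \<inter> T \<noteq> {}"
  shows "walk_connected r (S \<union> T)"
proof -
  obtain c where c: "c \<in> S" "c \<in> T" using assms(3) by blast
  have "(a, c) \<in> rtrancl_on (S \<union> T) r \<and> (c, a) \<in> rtrancl_on (S \<union> T) r" if "a \<in> S \<union> T" for a
  proof (cases "a \<in> S")
    case True
    then show ?thesis
      using walk_connectedD[OF assms(1)] c by (blast intro: rtrancl_on_mono[of r r S "S \<union> T"])
  next
    case False
    then show ?thesis
      using walk_connectedD[OF assms(2)] c that
      by (blast intro: rtrancl_on_mono[of r r T "S \<union> T"])
  qed
  then show ?thesis
    unfolding walk_connected_def by (blast intro: rtrancl_on_trans)
qed

lemma walk_connected_star:
  assumes "sym r" "c \<in> S" "\<And>a. a \<in> S \<Longrightarrow> (a, c) \<in> rtrancl_on S r"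
  shows "walk_connected r S"
  unfolding walk_connected_def
  using assms rtrancl_on_sym[OF assms(1)] by (meson rtrancl_on_trans symD)

text \<open>
  The vertex \<open>c\<close> is the one that follows the last visit of the walk to \<open>a\<close>.
\<close>
lemma rtrancl_on_last_exit:
  assumes "(a, b) \<in> rtrancl_on S r" "a \<noteq> b"
  obtains c where "(a, c) \<in> r" "(c, b) \<in> rtrancl_on (S - {a}) r"
proof -
  have "b \<noteq> a \<longrightarrow> (\<exists>c. (a, c) \<in> r \<and> (c, b) \<in> rtrancl_on (S - {a}) r)"
    using assms(1)
  proof (induction rule: rtrancl_on_induct)
    case base
    then show ?case by blast
  next
    case (step y z)
    show ?case
    proof
      assume "z \<noteq> a"
      show "\<exists>c. (a, c) \<in> r \<and> (c, z) \<in> rtrancl_on (S - {a}) r"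
      proof (cases "y = a")
        case True
        with step \<open>z \<noteq> a\<close> show ?thesis
          by (intro exI[of _ z]) (auto intro: rtrancl_on_refl)
      next
        case False
        then obtain c where "(a, c) \<in> r" "(c, y) \<in> rtrancl_on (S - {a}) r"
          using step by blast
        with step \<open>z \<noteq> a\<close> show ?thesis
          by (meson DiffI empty_iff insert_iff rtrancl_on_into_rtrancl_on)
      qed
    qed
  qed
  then show thesis using assms(2) that by blast
qed

text \<open>
  If no vertex lies in all the sets, then at every vertex \<open>t\<close> some set is missing and lies, being
  connected, in one branch at \<open>t\<close>. Let the branch \<open>D t p\<close> behind the edge from \<open>t\<close> to \<open>p\<close> contain a
  set of the family and be minimal with this property. Some set avoids \<open>p\<close>; as it meets the
  set inside \<open>D t p\<close>, it lies in a branch \<open>D p q\<close> with \<open>q \<noteq> t\<close>, which is a proper subset of \<open>D t p\<close>.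
  The absence of cycles enters as the fact that different neighbours of a vertex are
  separated by it.
\<close>
lemma subtrees_Helly:
  fixes r :: "'t rel"
  assumes "sym r" "finite V" "V \<noteq> {}" "walk_connected r V"
    and acyclic: "\<And>m p u. m \<in> V \<Longrightarrow> (m, p) \<in> r \<Longrightarrow> (m, u) \<in> r \<Longrightarrow>
      (p, u) \<in> rtrancl_on (V - {m}) r \<Longrightarrow> p = u"
    and sub: "\<And>A. A \<in> F \<Longrightarrow> A \<subseteq> V" and conn: "\<And>A. A \<in> F \<Longrightarrow> walk_connected r A"
    and meet: "\<And>A B. A \<in> F \<Longrightarrow> B \<in> F \<Longrightarrow> A \<inter> B \<noteq> {}"
  obtains t where "t \<in> V" "\<And>A. A \<in> F \<Longrightarrow> t \<in> A"
proof (rule ccontr)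
  assume "\<not> thesis"
  with that have none: "\<exists>A\<in>F. t \<notin> A" if "t \<in> V" for t
    using \<open>t \<in> V\<close> by blast
  define D where "D t p = {v. (p, v) \<in> rtrancl_on (V - {t}) r}" for t p
  have D_sub: "D t p \<subseteq> V" for t p
    by (auto simp: D_def dest: in_rtrancl_on_in_F)
  have inside: "A \<subseteq> D t p" if "A \<in> F" "t \<notin> A" "w \<in> A" "w \<in> D t p" for A t p w
  proof
    fix v assume "v \<in> A"
    then have "(w, v) \<in> rtrancl_on A r"
      using conn that by (blast dest: walk_connectedD)
    moreover have "A \<subseteq> V - {t}"
      using sub that by blast
    ultimately have "(w, v) \<in> rtrancl_on (V - {t}) r"
      by (blast intro: rtrancl_on_mono)
    then show "v \<in> D t p"
      using that(4) unfolding D_def by (blast intro: rtrancl_on_trans)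
  qed
  have "False" if "t \<in> V" "(t, p) \<in> r" "A \<in> F" "A \<subseteq> D t p" for t p A
    using that
  proof (induction "card (D t p)" arbitrary: t p A rule: less_induct)
    case less
    have "A \<noteq> {}"
      using meet[OF less.prems(3) less.prems(3)] by blast
    then have p: "p \<in> V" "p \<noteq> t" "p \<in> D t p"
      using less.prems(4) unfolding D_def by (auto dest: in_rtrancl_on_in_F intro: rtrancl_on_refl)
    obtain B where B: "B \<in> F" "p \<notin> B"
      using none p by blast
    obtain w where w: "w \<in> A" "w \<in> B"
      using meet less.prems(3) B(1) by blast
    have "(p, w) \<in> rtrancl_on (V - {t}) r" "p \<noteq> w"
      using w less.prems(4) B(2) by (auto simp: D_def)
    then obtain q where q: "(p, q) \<in> r" "(q, w) \<in> rtrancl_on (V - {t} - {p}) r"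
      by (rule rtrancl_on_last_exit)
    have "q \<noteq> t"
      using q(2) by (auto dest: in_rtrancl_on_in_F)
    have "(q, w) \<in> rtrancl_on (V - {p}) r"
      by (rule rtrancl_on_mono[OF _ _ q(2)]) auto
    then have "w \<in> D p q" by (simp add: D_def)
    (* Otherwise the neighbours q and t of p would be joined by a walk that avoids p. *)
    have "t \<notin> D p q"
    proof
      assume "t \<in> D p q"
      then have "(q, t) \<in> rtrancl_on (V - {p}) r" by (simp add: D_def)
      moreover have "(p, t) \<in> r"
        using less.prems(2) assms(1) by (blast dest: symD)
      ultimately show False
        using acyclic p(1) q(1) \<open>q \<noteq> t\<close> by blast
    qed
    have "D p q \<subseteq> D t p - {p}"
    proof
      fix v assume v: "v \<in> D p q"
      then have "(q, v) \<in> rtrancl_on (V - {p}) r" by (simp add: D_def)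
      then have "(q, v) \<in> rtrancl_on (V - {t}) r \<and> v \<in> D p q"
      proof (induction rule: rtrancl_on_induct)
        case base
        then show ?case
          using \<open>q \<noteq> t\<close> by (auto simp: D_def intro: rtrancl_on_refl)
      next
        case (step y z)
        have "z \<in> D p q"
          using step by (auto simp: D_def intro: rtrancl_on_into_rtrancl_on)
        moreover from this have "z \<noteq> t"
          using \<open>t \<notin> D p q\<close> by blast
        ultimately show ?case
          using step by (auto intro: rtrancl_on_into_rtrancl_on)
      qed
      then have "(q, v) \<in> rtrancl_on (V - {t}) r" by blast
      with q(1) p have "(p, v) \<in> rtrancl_on (V - {t}) r"
        by (auto intro: converse_rtrancl_on_into_rtrancl_on)
      moreover have "v \<noteq> p"
        using v by (auto simp: D_def dest: in_rtrancl_on_in_F)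
      ultimately show "v \<in> D t p - {p}" by (simp add: D_def)
    qed
    then have "D p q \<subset> D t p"
      using p(3) by blast
    then have "card (D p q) < card (D t p)"
      using D_sub assms(2) by (meson finite_subset psubset_card_mono)
    moreover have "B \<subseteq> D p q"
      using inside B w \<open>w \<in> D p q\<close> by blast
    ultimately show False
      using less.hyps p(1) q(1) B(1) by blast
  qed
  moreover obtain t where t: "t \<in> V" using assms(3) by blast
  moreover obtain A where A: "A \<in> F" "t \<notin> A" using none t by blast
  moreover obtain w where w: "w \<in> A" using meet A by blast
  moreover obtain p where "(t, p) \<in> r" "(p, w) \<in> rtrancl_on (V - {t}) r"
  proof -
    have "(t, w) \<in> rtrancl_on V r" "t \<noteq> w"
      using walk_connectedD[OF assms(4)] t sub A w by blast+
    then show thesis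
      by (rule rtrancl_on_last_exit) (rule that)
  qed
  moreover from this have "A \<subseteq> D t p"
    using inside A w by (auto simp: D_def)
  ultimately show False by blast
qed

lemma connected_imp_walk_connected:
  assumes "pair_graph T" "connected (with_proj T \<restriction> S)" "S \<subseteq> pverts T"
  shows "walk_connected (parcs T) S" "S \<noteq> {}"
proof -
  interpret pair_graph T by fact
  have sc: "strongly_connected (with_proj (mk_symmetric (with_proj T \<restriction> S)))"
    using assms(2) by (simp add: Digraph_Component.connected_def)
  show "S \<noteq> {}"
    using sc by (auto simp: strongly_connected_def)
  have "parcs (mk_symmetric (with_proj T \<restriction> S)) \<subseteq> parcs T"
    by (auto simp: parcs_mk_symmetric induce_subgraph_def arcs_ends_conv intro: arcs_symmetric)
  then show "walk_connected (parcs T) S"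
    using sc unfolding walk_connected_def strongly_connected_def reachable_def
    by (auto intro: rtrancl_on_mono[rotated 2])
qed

text \<open>
  A walk between two neighbours of \<open>m\<close> that avoids \<open>m\<close> shortens to a path, and closing this path
  through \<open>m\<close> gives a cycle. It has length at least 3 because the two neighbours differ.
\<close>
lemma undirected_tree_acyclic:
  assumes T: "undirected_tree T"
    and "m \<in> pverts T" and mp: "(m, p) \<in> parcs T" and mu: "(m, u) \<in> parcs T"
    and walk: "(p, u) \<in> rtrancl_on (pverts T - {m}) (parcs T)"
  shows "p = u"
proof (rule ccontr)
  assume "p \<noteq> u"
  interpret pair_graph T
    using T by (simp add: undirected_tree_def)
  define H where "H = with_proj T \<restriction> (pverts T - {m})"
  interpret H: wf_digraph H
    unfolding H_def by (rule wellformed_induce_subgraph)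
  have V: "verts H = pverts T - {m}" "arcs_ends H \<supseteq> parcs T \<inter> verts H \<times> verts H"
    unfolding H_def by (auto simp: induce_subgraph_def arcs_ends_conv)
  have "p \<rightarrow>\<^sup>*\<^bsub>H\<^esub> u"
    using walk unfolding reachable_def V(1)[symmetric]
  proof (induction rule: rtrancl_on_induct)
    case base
    then show ?case by simp
  next
    case (step y z)
    then have "(y, z) \<in> arcs_ends H"
      using V by blast
    with step show ?case
      by (blast intro: rtrancl_on_into_rtrancl_on)
  qed
  then obtain w where w: "H.apath p w u"
    by (auto simp: H.reachable_apath)
  have sub: "subgraph H (with_proj T)"
    unfolding H_def by (rule subgraph_induce_subgraphI) auto
  have verts: "H.awalk_verts = pawalk_verts"
    unfolding H_def by (rule awalk_verts_induce)
  have wT: "awalk p w u"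
    using w sub subgraph_awalk_imp_awalk unfolding H.apath_def by blast
  have dist: "distinct (pawalk_verts p w)"
    using w unfolding H.apath_def verts by blast
  have "set (pawalk_verts p w) \<subseteq> verts H"
    using w verts unfolding H.apath_def by (metis H.awalkE)
  then have m: "m \<notin> set (pawalk_verts p w)"
    using V by blast
  define c where "c = (m, p) # w @ [(u, m)]"
  have "(u, m) \<in> parcs T"
    using mu by (rule arcs_symmetric)
  then have "awalk m c m"
    unfolding c_def using wT mp
    by (auto simp: awalk_Cons_iff awalk_append_iff awalk_simps intro: in_arcsD1 in_arcsD2)
  moreover have "pawalk_verts m c = m # pawalk_verts p w @ [m]"
  proof -
    have "awalk p (w @ [(u, m)]) m"
      using wT mu \<open>(u, m) \<in> parcs T\<close>
      by (auto simp: awalk_simps intro: in_arcsD1)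
    then show ?thesis
      by (simp add: c_def awalk_verts_append del: awalk_append_iff)
  qed
  ultimately have "cycle c"
    using dist m unfolding cycle_def by (intro exI[of _ m]) (auto simp: c_def)
  moreover have "length c \<ge> 3"
    using wT \<open>p \<noteq> u\<close> by (cases w) (auto simp: c_def awalk_Nil_iff)
  ultimately show False
    using T unfolding undirected_tree_def by blast
qed

section \<open>A lower bound on the treewidth\<close>

text \<open>
  The treewidth is an infimum of natural numbers, hence attained as soon as there is some
  decomposition. The tree with a single node, whose bag contains all vertices, is one.
\<close>
lemma treewidth_attained:
  assumes "pair_graph G"
  obtains T :: "nat pair_pre_digraph" and B
  where "tree_decomposition G T B" "treewidth G = decomposition_width T B"
proof -
  define T :: "nat pair_pre_digraph" where "T = \<lparr>pverts = {0}, parcs = {}\<rparr>"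
  have T: "pair_graph T"
    by unfold_locales (auto simp: T_def symmetric_def sym_def)
  then interpret T: pair_graph T .
  have conn: "connected (with_proj T \<restriction> {0})"
    by (auto simp: Digraph_Component.connected_def strongly_connected_def reachable_def
      parcs_mk_symmetric induce_subgraph_def T_def)
  have "undirected_tree T"
    unfolding undirected_tree_def
  proof (intro conjI notI)
    have "with_proj T \<restriction> {0} = with_proj T"
      by (simp add: induce_subgraph_def T_def with_proj_def)
    then show "connected (with_proj T)" using conn by simp
  next
    assume "\<exists>p. pre_digraph.cycle (with_proj T) p \<and> 3 \<le> length p"
    then show False
      unfolding T.cycle_def T.awalk_def by (auto simp: T_def)
  qed (rule T)
  then have "tree_decomposition G T (\<lambda>_. pverts G)"
    using assms conn unfolding tree_decomposition_def
    by (auto simp: T_def pair_graph_def pair_digraph_def pair_fin_digraph_def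
        pair_wf_digraph.in_arcsD1 pair_wf_digraph.in_arcsD2)
  then have "{decomposition_width T B | (T :: nat pair_pre_digraph) B. tree_decomposition G T B} \<noteq> {}"
    by blast
  then have "treewidth G \<in> {decomposition_width T B | (T :: nat pair_pre_digraph) B. tree_decomposition G T B}"
    unfolding treewidth_def by (rule Inf_nat_def1)
  then show thesis using that by blast
qed

lemma card_le_if_disjoint_transversal:
  assumes "finite B" "disjoint_family_on R I" "\<And>i. i \<in> I \<Longrightarrow> B \<inter> R i \<noteq> {}"
  shows "card I \<le> card B"
proof -
  obtain f where f: "\<And>i. i \<in> I \<Longrightarrow> f i \<in> B \<inter> R i"
    using bchoice[of I "\<lambda>i x. x \<in> B \<inter> R i"] assms(3) by blast
  have "inj_on f I"
    using f assms(2) unfolding inj_on_def disjoint_family_on_def by (metis Int_iff disjoint_iff)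
  moreover have "f ` I \<subseteq> B" using f by blast
  ultimately show ?thesis using assms(1) by (metis card_inj_on_le)
qed

text \<open>
  The nodes whose bag meets a connected set \<open>X\<close> form a subtree: the nodes of a single vertex
  are connected by definition, and those of adjacent vertices share a node. Intersecting
  sets \<open>X\<close> yield intersecting subtrees, so the Helly property supplies the node \<open>t\<close>.
\<close>
lemma tree_decomposition_covers:
  assumes G: "pair_graph G" and dec: "tree_decomposition G T B"
    and sub: "\<And>X. X \<in> F \<Longrightarrow> X \<subseteq> pverts G" and conn: "\<And>X. X \<in> F \<Longrightarrow> walk_connected (parcs G) X"
    and meet: "\<And>X Y. X \<in> F \<Longrightarrow> Y \<in> F \<Longrightarrow> X \<inter> Y \<noteq> {}"
  obtains t where "t \<in> pverts T" "\<And>X. X \<in> F \<Longrightarrow> B t \<inter> X \<noteq> {}"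
proof -
  have T: "undirected_tree T" and bags: "(\<Union>t\<in>pverts T. B t) = pverts G"
    and edge: "\<And>u v. (u, v) \<in> parcs G \<Longrightarrow> \<exists>t\<in>pverts T. u \<in> B t \<and> v \<in> B t"
    and occ: "\<And>v. v \<in> pverts G \<Longrightarrow> connected (with_proj T \<restriction> {t \<in> pverts T. v \<in> B t})"
    using dec unfolding tree_decomposition_def by blast+
  have pT: "pair_graph T" and cT: "connected (with_proj T)"
    using T unfolding undirected_tree_def by blast+
  interpret T: pair_graph T by fact
  interpret G: pair_graph G by fact
  have "with_proj T \<restriction> pverts T = with_proj T"
    by (auto simp: induce_subgraph_def with_proj_def dest: T.in_arcsD1 T.in_arcsD2)
  with cT pT have V: "walk_connected (parcs T) (pverts T)" "pverts T \<noteq> {}"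
    using connected_imp_walk_connected[of T "pverts T"] by simp_all
  define tr where "tr X = {t \<in> pverts T. B t \<inter> X \<noteq> {}}" for X
  have single: "walk_connected (parcs T) (tr {v})" "tr {v} \<noteq> {}" if "v \<in> pverts G" for v
    using connected_imp_walk_connected[OF pT occ[OF that]] by (auto simp: tr_def)
  have mono: "tr X \<subseteq> tr Y" if "X \<subseteq> Y" for X Y
    using that by (auto simp: tr_def)
  have trc: "walk_connected (parcs T) (tr X)" if X: "X \<in> F" for X
    unfolding walk_connected_def
  proof (intro ballI)
    fix s t assume s: "s \<in> tr X" and t: "t \<in> tr X"
    obtain a b where a: "a \<in> X" "s \<in> tr {a}" and b: "b \<in> X" "t \<in> tr {b}"
      using s t by (auto simp: tr_def)
    (* The walk from a to b in X is followed in the tree, from the nodes of one vertex to those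
       of the next. *)
    have "(a, b) \<in> rtrancl_on X (parcs G)"
      using conn X a b by (blast dest: walk_connectedD)
    then have "\<forall>t\<in>tr {b}. (s, t) \<in> rtrancl_on (tr X) (parcs T)"
    proof (induction rule: rtrancl_on_induct)
      case base
      have "(s, t) \<in> rtrancl_on (tr {a}) (parcs T)" if "t \<in> tr {a}" for t
        using single(1) sub X a that by (blast dest: walk_connectedD)
      then show ?case
        using mono[of "{a}" X] a(1) by (blast intro: rtrancl_on_mono)
    next
      case (step y z)
      obtain t' where "t' \<in> tr {y}" "t' \<in> tr {z}"
        using edge[OF step.hyps(2)] by (auto simp: tr_def)
      moreover have "(t', t) \<in> rtrancl_on (tr X) (parcs T)" if "t \<in> tr {z}" for t
      proof -
        have "(t', t) \<in> rtrancl_on (tr {z}) (parcs T)"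
          using single(1) sub X step \<open>t' \<in> tr {z}\<close> that by (blast dest: walk_connectedD)
        then show ?thesis
          using mono[of "{z}" X] step by (blast intro: rtrancl_on_mono)
      qed
      ultimately show ?case
        using step.IH by (blast intro: rtrancl_on_trans)
    qed
    then show "(s, t) \<in> rtrancl_on (tr X) (parcs T)"
      using b by blast
  qed
  have trm: "tr X \<inter> tr Y \<noteq> {}" if XY: "X \<in> F" "Y \<in> F" for X Y
  proof -
    obtain v where "v \<in> X" "v \<in> Y" using meet XY by blast
    then show ?thesis
      using single(2)[of v] mono[of "{v}"] sub XY by blast
  qed
  have "sym (parcs T)"
    using T.arcs_symmetric by (blast intro: symI)
  then obtain t where t: "t \<in> pverts T" "\<And>A. A \<in> tr ` F \<Longrightarrow> t \<in> A"
  proof (rule subtrees_Helly)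
    show "finite (pverts T)" by (rule T.pair_finite_verts)
    show "pverts T \<noteq> {}" "walk_connected (parcs T) (pverts T)" by (rule V)+
    show "p = u" if "m \<in> pverts T" "(m, p) \<in> parcs T" "(m, u) \<in> parcs T"
      "(p, u) \<in> rtrancl_on (pverts T - {m}) (parcs T)" for m p u
      using T that by (rule undirected_tree_acyclic)
    show "A \<subseteq> pverts T" if "A \<in> tr ` F" for A
      using that by (auto simp: tr_def)
    show "walk_connected (parcs T) A" if "A \<in> tr ` F" for A
      using that trc by blast
    show "A \<inter> A' \<noteq> {}" if "A \<in> tr ` F" "A' \<in> tr ` F" for A A'
      using that trm by blast
  qed blast
  show thesis
    using that[OF t(1)] t(2) by (auto simp: tr_def)
qed

text \<open>
  The unions of a row and a column form a bramble. A bag that misses a row and a column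
  misses their union, so the covering bag meets all rows or all columns, and these are
  disjoint. The \<open>1\<close> is the one subtracted in the definition of the width.
\<close>
lemma treewidth_ge_crossing:
  assumes G: "pair_graph G"
    and R: "\<And>i. i \<in> I \<Longrightarrow> R i \<subseteq> pverts G" "\<And>i. i \<in> I \<Longrightarrow> walk_connected (parcs G) (R i)"
      "disjoint_family_on R I"
    and C: "\<And>j. j \<in> J \<Longrightarrow> C j \<subseteq> pverts G" "\<And>j. j \<in> J \<Longrightarrow> walk_connected (parcs G) (C j)"
      "disjoint_family_on C J"
    and cross: "\<And>i j. i \<in> I \<Longrightarrow> j \<in> J \<Longrightarrow> R i \<inter> C j \<noteq> {}"
    and k: "k \<le> card I" "k \<le> card J"
  shows "k \<le> treewidth G + 1"
proof -
  interpret G: pair_graph G by fact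
  obtain T :: "nat pair_pre_digraph" and B where dec: "tree_decomposition G T B"
    and tw: "treewidth G = decomposition_width T B"
    using treewidth_attained[OF G] .
  define F where "F = {R i \<union> C j | i j. i \<in> I \<and> j \<in> J}"
  obtain t where t: "t \<in> pverts T" "\<And>X. X \<in> F \<Longrightarrow> B t \<inter> X \<noteq> {}"
  proof (rule tree_decomposition_covers[OF G dec, of F])
    show "walk_connected (parcs G) X" if "X \<in> F" for X
      using that R C cross by (auto simp: F_def intro!: walk_connected_Un)
    show "X \<inter> Y \<noteq> {}" if XY: "X \<in> F" "Y \<in> F" for X Y
    proof -
      obtain i j i' j' where "X = R i \<union> C j" "Y = R i' \<union> C j'" "i \<in> I" "j' \<in> J"
        using XY unfolding F_def by blast
      then show ?thesis using cross[of i j'] by blast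
    qed
    show "X \<subseteq> pverts G" if "X \<in> F" for X
      using that R(1) C(1) unfolding F_def by blast
  qed blast
  have "B t \<subseteq> pverts G"
    using dec t(1) by (auto simp: tree_decomposition_def)
  then have fin: "finite (B t)"
    using G.pair_finite_verts by (rule finite_subset)
  have "(\<forall>i\<in>I. B t \<inter> R i \<noteq> {}) \<or> (\<forall>j\<in>J. B t \<inter> C j \<noteq> {})"
  proof (rule ccontr)
    assume "\<not> ?thesis"
    then obtain i j where "i \<in> I" "j \<in> J" "B t \<inter> (R i \<union> C j) = {}" by blast
    then show False using t(2)[of "R i \<union> C j"] by (auto simp: F_def)
  qed
  then have "k \<le> card (B t)"
    using card_le_if_disjoint_transversal[OF fin R(3)] card_le_if_disjoint_transversal[OF fin C(3)] k
    by (meson le_trans)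
  moreover have "card (B t) \<le> Max ((\<lambda>t. card (B t)) ` pverts T)"
  proof -
    have "finite (pverts T)"
      using dec unfolding tree_decomposition_def undirected_tree_def
      by (simp add: pair_graph_def pair_digraph_def pair_fin_digraph_def pair_fin_digraph_axioms_def)
    then show ?thesis using t(1) by (intro Max_ge) auto
  qed
  ultimately show ?thesis
    unfolding tw decomposition_width_def by linarith
qed

section \<open>Disk graphs in the upper half-plane\<close>

text \<open>
  The Cayley transform from the upper half-plane to the unit disk that takes \<open>\<i> * Y\<close> to the origin.
\<close>
definition cayley :: "real \<Rightarrow> complex \<Rightarrow> complex" where
  "cayley Y z = (z - \<i> * of_real Y) / (z + \<i> * of_real Y)"

lemma one_minus_norm_cayley:
  assumes "Im z > 0" "Y > 0"
  shows "1 - (cmod (cayley Y z))\<^sup>2 = 4 * Y * Im z / (cmod (z + \<i> * of_real Y))\<^sup>2"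
    and "cmod (z + \<i> * of_real Y) > 0"
proof -
  have "Im (z + \<i> * of_real Y) > 0" using assms by simp
  then show pos: "cmod (z + \<i> * of_real Y) > 0"
    by (metis norm_zero zero_complex.sel(2) zero_less_norm_iff less_irrefl)
  have "(cmod (z + \<i> * of_real Y))\<^sup>2 - (cmod (z - \<i> * of_real Y))\<^sup>2 = 4 * Y * Im z"
    unfolding cmod_power2 by (simp add: power2_eq_square algebra_simps)
  moreover have "(cmod (cayley Y z))\<^sup>2 =
      (cmod (z - \<i> * of_real Y))\<^sup>2 / (cmod (z + \<i> * of_real Y))\<^sup>2"
    by (simp add: cayley_def norm_divide power_divide)
  moreover have "(cmod (z + \<i> * of_real Y))\<^sup>2 \<noteq> 0"
    using pos by simp
  ultimately show "1 - (cmod (cayley Y z))\<^sup>2 = 4 * Y * Im z / (cmod (z + \<i> * of_real Y))\<^sup>2"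
    by (simp add: field_simps)
qed

text \<open>
  The right-hand side is the hyperbolic distance in the half-plane model; the Cayley
  transform is an isometry, whichever point \<open>\<i> * Y\<close> is moved to the origin.
\<close>
lemma hyp_dist_cayley:
  assumes "Im z > 0" "Im w > 0" "Y > 0"
  shows "hyp_dist (cayley Y z) (cayley Y w) = arcosh (1 + (cmod (z - w))\<^sup>2 / (2 * Im z * Im w))"
proof -
  define a where "a = z + \<i> * of_real Y"
  define b where "b = w + \<i> * of_real Y"
  have pos: "cmod a > 0" "cmod b > 0"
    unfolding a_def b_def using one_minus_norm_cayley(2) assms by blast+
  then have "a \<noteq> 0" "b \<noteq> 0" by auto
  then have "cayley Y z - cayley Y w = 2 * \<i> * of_real Y * (z - w) / (a * b)"
    unfolding cayley_def a_def[symmetric] b_def[symmetric]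
    by (simp add: divide_simps) (simp add: a_def b_def algebra_simps)
  then have "(cmod (cayley Y z - cayley Y w))\<^sup>2 = 4 * Y\<^sup>2 * (cmod (z - w))\<^sup>2 / ((cmod a)\<^sup>2 * (cmod b)\<^sup>2)"
    by (simp add: norm_mult norm_divide power_divide power_mult_distrib)
  moreover have "1 - (cmod (cayley Y z))\<^sup>2 = 4 * Y * Im z / (cmod a)\<^sup>2"
    "1 - (cmod (cayley Y w))\<^sup>2 = 4 * Y * Im w / (cmod b)\<^sup>2"
    unfolding a_def b_def using one_minus_norm_cayley(1) assms by blast+
  ultimately have "2 * (cmod (cayley Y z - cayley Y w))\<^sup>2 /
        ((1 - (cmod (cayley Y z))\<^sup>2) * (1 - (cmod (cayley Y w))\<^sup>2)) =
      2 * (4 * Y\<^sup>2 * (cmod (z - w))\<^sup>2 / ((cmod a)\<^sup>2 * (cmod b)\<^sup>2)) /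
        ((4 * Y * Im z / (cmod a)\<^sup>2) * (4 * Y * Im w / (cmod b)\<^sup>2))"
    by (simp only:)
  also have "\<dots> = (cmod (z - w))\<^sup>2 / (2 * Im z * Im w)"
    using assms pos by (simp add: field_simps power2_eq_square)
  finally have "2 * (cmod (cayley Y z - cayley Y w))\<^sup>2 /
      ((1 - (cmod (cayley Y z))\<^sup>2) * (1 - (cmod (cayley Y w))\<^sup>2)) = (cmod (z - w))\<^sup>2 / (2 * Im z * Im w)" .
  then show ?thesis
    by (simp add: hyp_dist_def)
qed

text \<open>
  The distance condition becomes polynomial in the coordinates, because
  \<open>cosh (2 * r) = 1 + 2 * (sinh r)\<^sup>2\<close>.
\<close>
lemma hyp_dist_cayley_le_iff:
  assumes "Im z > 0" "Im w > 0" "Y > 0" "r \<ge> 0"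
  shows "hyp_dist (cayley Y z) (cayley Y w) \<le> 2 * r \<longleftrightarrow>
    (Re z - Re w)\<^sup>2 + (Im z - Im w)\<^sup>2 \<le> 4 * (sinh r)\<^sup>2 * Im z * Im w"
proof -
  define d where "d = (cmod (z - w))\<^sup>2 / (2 * Im z * Im w)"
  have "d \<ge> 0" using assms by (simp add: d_def)
  then have "arcosh (1 + d) \<le> 2 * r \<longleftrightarrow> 1 + d \<le> cosh (2 * r)"
    using cosh_real_nonneg_le_iff[of "arcosh (1 + d)" "2 * r"] assms(4)
    by (simp add: arcosh_nonneg_real)
  also have "cosh (2 * r) = 1 + 2 * (sinh r)\<^sup>2"
    using cosh_double_cosh[of r] cosh_square_eq[of r] by simp
  also have "1 + d \<le> 1 + 2 * (sinh r)\<^sup>2 \<longleftrightarrow> (cmod (z - w))\<^sup>2 \<le> 4 * (sinh r)\<^sup>2 * Im z * Im w"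
    using assms by (simp add: d_def field_simps)
  finally show ?thesis
    using hyp_dist_cayley[OF assms(1-3)] by (simp add: d_def cmod_power2)
qed

lemma shudg_if_half_plane:
  fixes z :: "'a \<Rightarrow> complex"
  assumes "pair_graph G" "r > 0" "Y > 0"
    and pos: "\<And>v. v \<in> pverts G \<Longrightarrow> Im (z v) > 0"
    and centre: "\<And>v. v \<in> pverts G \<Longrightarrow>
      (Re (z v))\<^sup>2 + (Im (z v) - Y)\<^sup>2 \<le> 4 * (sinh r)\<^sup>2 * Im (z v) * Y"
    and adj: "\<And>u v. u \<in> pverts G \<Longrightarrow> v \<in> pverts G \<Longrightarrow> u \<noteq> v \<Longrightarrow> (u, v) \<in> parcs G \<longleftrightarrow>
      (Re (z u) - Re (z v))\<^sup>2 + (Im (z u) - Im (z v))\<^sup>2 \<le> 4 * (sinh r)\<^sup>2 * Im (z u) * Im (z v)"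
  shows "shudg r G"
proof -
  have "cayley Y (z v) \<in> hyp_plane \<and> hyp_dist 0 (cayley Y (z v)) \<le> 2 * r" if v: "v \<in> pverts G" for v
  proof
    have "1 - (cmod (cayley Y (z v)))\<^sup>2 > 0"
      using one_minus_norm_cayley[OF pos[OF v] assms(3)] pos[OF v] assms(3) by simp
    then show "cayley Y (z v) \<in> hyp_plane"
      by (simp add: hyp_plane_def power_less_one_iff abs_square_less_1)
    have "cayley Y (\<i> * of_real Y) = 0"
      by (simp add: cayley_def)
    then show "hyp_dist 0 (cayley Y (z v)) \<le> 2 * r"
      using hyp_dist_cayley_le_iff[of "\<i> * of_real Y" "z v" Y r] centre[OF v] pos[OF v] assms(2,3)
      by (simp add: power2_commute mult.commute mult.left_commute mult.assoc)
  qed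
  then show ?thesis
    unfolding shudg_def using assms(1,2,3) adj pos hyp_dist_cayley_le_iff
    by (intro conjI exI[of _ "\<lambda>v. cayley Y (z v)"]) auto
qed

section \<open>The level graph of a set of levels\<close>

definition point :: "nat \<Rightarrow> nat \<Rightarrow> nat" where
  "point j m = 4 ^ j * (2 * m + 1)"

text \<open>
  A vertex is identified with its abscissa, a natural number \<open>4 ^ j * (2 * m + 1)\<close>, from which its
  level \<open>j\<close> can be read off.
\<close>
definition level :: "nat \<Rightarrow> nat" where
  "level x = multiplicity 4 x"

lemma level_point [simp]: "level (point j m) = j"
proof -
  have "\<not> 4 ^ Suc j dvd (4::nat) ^ j * (2 * m + 1)"
  proof
    assume "4 ^ Suc j dvd (4::nat) ^ j * (2 * m + 1)"
    then have "4 ^ j * 4 dvd (4::nat) ^ j * (2 * m + 1)"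
      by (simp only: power_Suc2)
    then have "4 dvd 2 * m + 1"
      by (subst (asm) dvd_times_left_cancel_iff) auto
    then have "even (2 * m + 1)" by (metis dvd_trans even_numeral)
    then show False by simp
  qed
  then show ?thesis
    unfolding level_def point_def by (intro multiplicity_eqI) auto
qed

text \<open>
  The bound on \<open>m\<close> cuts every level off at the same abscissa \<open>2 * card L * 4 ^ Max L\<close>.
\<close>
definition points :: "nat set \<Rightarrow> nat set" where
  "points L = {point j m | j m. j \<in> L \<and> m < card L * 4 ^ (Max L - j)}"

text \<open>
  The threshold is the geometric mean of the heights \<open>2 * 4 ^ level x\<close> and \<open>2 * 4 ^ level y\<close>.
\<close>
definition close :: "nat \<Rightarrow> nat \<Rightarrow> bool" where
  "close x y \<longleftrightarrow> \<bar>int x - int y\<bar> \<le> 2 * 2 ^ (level x + level y)"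

definition level_graph :: "nat set \<Rightarrow> nat pair_pre_digraph" where
  "level_graph L =
     \<lparr>pverts = points L, parcs = {(x, y). x \<in> points L \<and> y \<in> points L \<and> x \<noteq> y \<and> close x y}\<rparr>"

lemma pverts_level_graph [simp]: "pverts (level_graph L) = points L"
  by (simp add: level_graph_def)

lemma arc_level_graph_iff:
  "(x, y) \<in> parcs (level_graph L) \<longleftrightarrow> x \<in> points L \<and> y \<in> points L \<and> x \<noteq> y \<and> close x y"
  by (simp add: level_graph_def)

lemma close_sym: "close x y \<Longrightarrow> close y x"
  by (simp add: close_def abs_minus_commute add.commute)

lemma pointsE:
  assumes "x \<in> points L"
  obtains m where "x = point (level x) m" "level x \<in> L" "m < card L * 4 ^ (Max L - level x)"
  using assms by (auto simp: points_def)

lemma pointI: "j \<in> L \<Longrightarrow> m < card L * 4 ^ (Max L - j) \<Longrightarrow> point j m \<in> points L"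
  unfolding points_def by blast

lemma pow4_level_dvd: "x \<in> points L \<Longrightarrow> 4 ^ level x dvd x"
  by (erule pointsE) (metis dvd_triv_left point_def)

text \<open>
  The points of level \<open>0\<close> bring the number of vertices to the order \<open>card L * 4 ^ Max L\<close>.
\<close>
locale level_set =
  fixes L :: "nat set"
  assumes finite_levels: "finite L" and zero_level: "0 \<in> L"
begin

abbreviation h where "h \<equiv> Max L"
abbreviation k where "k \<equiv> card L"

lemma Max_level: "h \<in> L"
  using finite_levels zero_level by (intro Max_in) auto

lemma level_le_Max: "j \<in> L \<Longrightarrow> j \<le> h"
  using finite_levels by (rule Max_ge)

lemma k_pos: "k > 0"
  using finite_levels zero_level by (auto simp: card_gt_0_iff)

lemma pow4_split: "j \<in> L \<Longrightarrow> (4::nat) ^ j * 4 ^ (h - j) = 4 ^ h"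
  using level_le_Max by (simp flip: power_add)

lemma points_less: "x \<in> points L \<Longrightarrow> x < 2 * (k * 4 ^ h)"
proof (erule pointsE)
  fix m assume m: "x = point (level x) m" "level x \<in> L" "m < k * 4 ^ (h - level x)"
  have "4 ^ level x * (2 * m + 1) < 4 ^ level x * (2 * (k * 4 ^ (h - level x)))"
    using m(3) by (intro mult_strict_left_mono) auto
  also have "\<dots> = 2 * (k * (4 ^ level x * 4 ^ (h - level x)))" by simp
  finally show ?thesis
    using m(1) pow4_split[OF m(2)] by (simp add: point_def)
qed

lemma finite_points: "finite (points L)"
  using points_less by (intro finite_subset[of "points L" "{..< 2 * (k * 4 ^ h)}"]) auto

lemma card_points: "k * 4 ^ h \<le> card (points L)" "card (points L) \<le> 2 * (k * 4 ^ h)"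
proof -
  have "point 0 ` {..< k * 4 ^ h} \<subseteq> points L"
    using zero_level by (fastforce simp: points_def)
  moreover have "inj_on (point 0) {..< k * 4 ^ h}"
    by (auto simp: inj_on_def point_def)
  ultimately show "k * 4 ^ h \<le> card (points L)"
    using finite_points by (metis card_image card_lessThan card_mono)
  show "card (points L) \<le> 2 * (k * 4 ^ h)"
    using card_mono[of "{..< 2 * (k * 4 ^ h)}" "points L"] points_less by auto
qed

lemma pair_graph_level_graph: "pair_graph (level_graph L)"
proof -
  have "parcs (level_graph L) \<subseteq> points L \<times> points L"
    by (auto simp: level_graph_def)
  then have "finite (parcs (level_graph L))"
    using finite_points by (meson finite_SigmaI finite_subset)
  then show ?thesis
    using finite_points
    by unfold_locales (auto simp: level_graph_def symmetric_def intro!: symI intro: close_sym)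
qed

text \<open>
  For \<open>i < j\<close> the threshold \<open>2 * 2 ^ (i + j)\<close> and the abscissa of a point of level \<open>j\<close> are divisible by
  \<open>4 ^ Suc i\<close>, but the abscissa of a point of level \<open>i\<close> is not.
\<close>
lemma dist_neq_threshold:
  assumes "x \<in> points L" "y \<in> points L" "level x < level y"
  shows "\<bar>int x - int y\<bar> \<noteq> 2 * 2 ^ (level x + level y)"
proof
  assume eq: "\<bar>int x - int y\<bar> = 2 * 2 ^ (level x + level y)"
  define i where "i = level x"
  have i: "Suc i \<le> level y" using assms(3) by (simp add: i_def)
  have two: "(4::int) ^ Suc i = 2 ^ (2 * Suc i)"
    by (simp add: power_mult)
  have "(4::int) ^ Suc i dvd 2 * 2 ^ (level x + level y)"
    unfolding two i_def[symmetric] using i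
    by (simp only: power_Suc[symmetric]) (rule le_imp_power_dvd, simp)
  then have "(4::int) ^ Suc i dvd int x - int y"
    by (metis eq dvd_abs_iff)
  moreover have "(4::int) ^ Suc i dvd int y"
  proof -
    have "4 ^ Suc i dvd y"
      using pow4_level_dvd[OF assms(2)] i by (meson dvd_trans le_imp_power_dvd)
    then show ?thesis by (metis of_nat_dvd_iff of_nat_power of_nat_numeral)
  qed
  ultimately have "(4::int) ^ Suc i dvd int x"
    by (metis diff_add_cancel dvd_add)
  then have "4 ^ Suc i dvd x"
    by (metis of_nat_dvd_iff of_nat_power of_nat_numeral)
  moreover have "x > 0"
    using assms(1) by (erule_tac pointsE) (metis add_gr_0 mult_pos_pos point_def zero_less_numeral zero_less_one zero_less_power)
  ultimately have "Suc i \<le> level x"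
    unfolding level_def by (intro multiplicity_geI) auto
  then show False by (simp add: i_def)
qed

text \<open>
  After stretching the abscissae by \<open>M = 2 * card L * 4 ^ h\<close>, the exact intersection condition reads
  \<open>M\<^sup>2 * (x - y)\<^sup>2 + (q x - q y)\<^sup>2 \<le> M\<^sup>2 * q x * q y\<close> for the heights \<open>q x\<close> and \<open>q y\<close>. The heights are at most
  \<open>M\<close>, so the second summand cannot exceed \<open>M\<^sup>2\<close>. It is harmless since on different levels the
  integers \<open>(x - y)\<^sup>2\<close> and \<open>q x * q y\<close> are never equal.
\<close>
lemma close_iff_hyperbolic:
  assumes x: "x \<in> points L" and y: "y \<in> points L"
  defines "p \<equiv> (\<lambda>x. 2 * int (k * 4 ^ h) * int x)" and "q \<equiv> (\<lambda>x. 2 * 4 ^ level x)"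
  shows "close x y \<longleftrightarrow> (p x - p y)\<^sup>2 + (q x - q y)\<^sup>2 \<le> 4 * (int (k * 4 ^ h))\<^sup>2 * q x * q y"
proof -
  define M where "M = 2 * int (k * 4 ^ h)"
  define D where "D = \<bar>int x - int y\<bar>"
  define c :: int where "c = 2 * 2 ^ (level x + level y)"
  have M: "M > 0" using k_pos by (simp add: M_def)
  have p: "(p x - p y)\<^sup>2 = M\<^sup>2 * D\<^sup>2"
    by (simp add: p_def M_def D_def power2_eq_square algebra_simps)
  have four: "((2::int) ^ n)\<^sup>2 = 4 ^ n" for n
    by (simp add: power2_eq_square flip: power_mult_distrib)
  have "c\<^sup>2 = q x * q y"
    by (simp add: c_def q_def power_mult_distrib power_add four)
  then have q: "4 * (int (k * 4 ^ h))\<^sup>2 * q x * q y = M\<^sup>2 * c\<^sup>2"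
    by (simp add: M_def power_mult_distrib)
  have dq: "(q x - q y)\<^sup>2 \<le> M\<^sup>2"
  proof -
    have "0 \<le> q z \<and> q z \<le> M" if "z \<in> points L" for z
    proof -
      have "level z \<le> h" using that level_le_Max by (blast elim: pointsE)
      then have "(4::int) ^ level z \<le> 4 ^ h" by (intro power_increasing) auto
      also have "\<dots> \<le> int k * 4 ^ h" using k_pos by simp
      finally show ?thesis by (simp add: q_def M_def)
    qed
    from this[OF x] this[OF y] have "\<bar>q x - q y\<bar> \<le> \<bar>M\<bar>" by linarith
    then show ?thesis by (simp add: abs_le_square_iff)
  qed
  show ?thesis
    unfolding p q
  proof
    assume "close x y"
    then have Dc: "D \<le> c" by (simp add: close_def D_def c_def)
    have D0: "D \<ge> 0" by (simp add: D_def)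
    show "M\<^sup>2 * D\<^sup>2 + (q x - q y)\<^sup>2 \<le> M\<^sup>2 * c\<^sup>2"
    proof (cases "level x = level y")
      case True
      then show ?thesis
        using Dc D0 M by (simp add: q_def power_mono)
    next
      case False
      have "D \<noteq> c"
      proof (cases "level x < level y")
        case True
        then show ?thesis using dist_neq_threshold[OF x y] by (simp add: D_def c_def)
      next
        case F: False
        then show ?thesis
          using dist_neq_threshold[OF y x] False by (simp add: D_def c_def abs_minus_commute add.commute)
      qed
      then have "(D + 1)\<^sup>2 \<le> c\<^sup>2"
        using Dc D0 by (intro power_mono) auto
      then have "D\<^sup>2 + 1 \<le> c\<^sup>2"
        using D0 by (simp add: power2_eq_square algebra_simps)
      then have "M\<^sup>2 * (D\<^sup>2 + 1) \<le> M\<^sup>2 * c\<^sup>2"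
        by (intro mult_left_mono) auto
      then show ?thesis using dq by (simp add: algebra_simps)
    qed
  next
    assume "M\<^sup>2 * D\<^sup>2 + (q x - q y)\<^sup>2 \<le> M\<^sup>2 * c\<^sup>2"
    then have "M\<^sup>2 * D\<^sup>2 \<le> M\<^sup>2 * c\<^sup>2"
      using zero_le_power2[of "q x - q y"] by linarith
    then have "D\<^sup>2 \<le> c\<^sup>2"
      using M by simp
    moreover have "c \<ge> 0" by (simp add: c_def)
    ultimately have "D \<le> c"
      by (rule power2_le_imp_le)
    then show "close x y"
      by (simp add: close_def D_def c_def)
  qed
qed

text \<open>
  With \<open>N = card L * 4 ^ h\<close> the stretching factor is \<open>2 * N\<close> and the radius satisfies \<open>sinh r = N\<close>. The
  origin is moved to the height \<open>4 * N\<^sup>2\<close>: since abscissae (before stretching) and heights are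
  at most \<open>2 * N\<close> and heights are at least \<open>2\<close>, all points are within distance \<open>2 * r\<close> of it.
\<close>
lemma shudg_level_graph: "shudg (arsinh (real (k * 4 ^ h))) (level_graph L)"
proof -
  define N where "N = real (k * 4 ^ h)"
  define z where "z x = Complex (2 * N * real x) (2 * 4 ^ level x)" for x
  have N: "N \<ge> 1"
  proof -
    have "1 \<le> k * 4 ^ h" using k_pos by (simp add: Suc_leI)
    then show ?thesis unfolding N_def by (metis of_nat_1 of_nat_le_iff)
  qed
  have sinh: "sinh (arsinh N) = N"
    by simp
  show ?thesis
    unfolding N_def[symmetric]
  proof (rule shudg_if_half_plane[of _ _ "4 * N\<^sup>2" z])
    show "pair_graph (level_graph L)" by (rule pair_graph_level_graph)
    show "arsinh N > 0" "4 * N\<^sup>2 > 0"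
      using N by simp_all
    show "Im (z v) > 0" for v
      by (simp add: z_def)
    fix x assume x: "x \<in> pverts (level_graph L)"
    define q :: real where "q = 2 * 4 ^ level x"
    have "level x \<le> h" using x level_le_Max by (auto elim: pointsE)
    then have "(4::real) ^ level x \<le> 4 ^ h" by (intro power_increasing) auto
    also have "\<dots> \<le> N" using k_pos by (simp add: N_def Suc_leI)
    finally have q: "q \<ge> 2" "q \<le> 2 * N"
      by (simp_all add: q_def)
    have "2 * N \<le> 4 * N\<^sup>2"
      using N by (simp add: power2_eq_square)
    with q have "\<bar>q - 4 * N\<^sup>2\<bar> \<le> \<bar>4 * N\<^sup>2\<bar>" by simp
    then have 1: "(q - 4 * N\<^sup>2)\<^sup>2 \<le> (4 * N\<^sup>2)\<^sup>2"
      by (simp only: abs_le_square_iff)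
    have "real x < real (2 * (k * 4 ^ h))"
      using points_less[of x] x by (simp only: of_nat_less_iff pverts_level_graph)
    then have "real x \<le> 2 * N"
      by (simp add: N_def)
    then have "2 * N * real x \<le> 2 * N * (2 * N)"
      using N by (intro mult_left_mono) auto
    then have "2 * N * real x \<le> 4 * N\<^sup>2"
      by (simp add: power2_eq_square)
    then have 2: "(2 * N * real x)\<^sup>2 \<le> (4 * N\<^sup>2)\<^sup>2"
      using N by (intro power_mono) auto
    have "2 * (4 * N\<^sup>2)\<^sup>2 \<le> q * (4 * N\<^sup>2)\<^sup>2"
      using q by (intro mult_right_mono) auto
    with 1 2 have "(2 * N * real x)\<^sup>2 + (q - 4 * N\<^sup>2)\<^sup>2 \<le> 4 * N\<^sup>2 * q * (4 * N\<^sup>2)"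
      by (simp add: power2_eq_square algebra_simps)
    then show "(Re (z x))\<^sup>2 + (Im (z x) - 4 * N\<^sup>2)\<^sup>2 \<le> 4 * (sinh (arsinh N))\<^sup>2 * Im (z x) * (4 * N\<^sup>2)"
      by (simp add: z_def q_def)
  next
    fix x y assume xy: "x \<in> pverts (level_graph L)" "y \<in> pverts (level_graph L)" "x \<noteq> y"
    have "(x, y) \<in> parcs (level_graph L) \<longleftrightarrow> close x y"
      using xy by (simp add: arc_level_graph_iff)
    also have "\<dots> \<longleftrightarrow> real_of_int ((2 * int (k * 4 ^ h) * int x - 2 * int (k * 4 ^ h) * int y)\<^sup>2
        + (2 * 4 ^ level x - 2 * 4 ^ level y)\<^sup>2)
        \<le> real_of_int (4 * (int (k * 4 ^ h))\<^sup>2 * (2 * 4 ^ level x) * (2 * 4 ^ level y))"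
      using close_iff_hyperbolic[of x y] xy by (simp only: of_int_le_iff pverts_level_graph)
    also have "\<dots> \<longleftrightarrow> (Re (z x) - Re (z y))\<^sup>2 + (Im (z x) - Im (z y))\<^sup>2
        \<le> 4 * (sinh (arsinh N))\<^sup>2 * Im (z x) * Im (z y)"
      by (simp add: z_def N_def mult.assoc)
    finally show "(x, y) \<in> parcs (level_graph L) \<longleftrightarrow> (Re (z x) - Re (z y))\<^sup>2 + (Im (z x) - Im (z y))\<^sup>2
        \<le> 4 * (sinh (arsinh N))\<^sup>2 * Im (z x) * Im (z y)" .
  qed
qed

end

section \<open>Cliques\<close>

lemma clique_number_le:
  assumes "pair_graph G"
    and "\<And>Q. Q \<subseteq> pverts G \<Longrightarrow> (\<And>x y. x \<in> Q \<Longrightarrow> y \<in> Q \<Longrightarrow> x \<noteq> y \<Longrightarrow> (x, y) \<in> parcs G) \<Longrightarrow> card Q \<le> b"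
  shows "clique_number G \<le> b"
proof -
  define A where "A = {k. \<exists>H. subgraph H (with_proj G) \<and> complete_digraph k H}"
  interpret G: pair_graph G by fact
  have le: "n \<le> b" if n: "n \<in> A" for n
  proof -
    obtain H where H: "subgraph H (with_proj G)" "complete_digraph n H"
      using n by (auto simp: A_def)
    have "arcs_ends H \<subseteq> parcs G"
      using arcs_ends_mono[OF H(1)] by simp
    then have "(x, y) \<in> parcs G" if "x \<in> verts H" "y \<in> verts H" "x \<noteq> y" for x y
      using that H(2) by (auto simp: complete_digraph_def)
    moreover have "verts H \<subseteq> pverts G"
      using H(1) by (auto simp: subgraph_def)
    ultimately have "card (verts H) \<le> b"
      using assms(2) by blast
    then show ?thesis using H(2) by (simp add: complete_digraph_def)
  qed
  (* The maximum in the definition exists because the empty graph is a complete subgraph. *)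
  have "0 \<in> A"
  proof -
    define E :: "'a pair_pre_digraph" where "E = \<lparr>pverts = {}, parcs = {}\<rparr>"
    have "complete_digraph 0 (with_proj E)"
      by (simp add: complete_digraph_pair_def E_def)
    moreover from this have "wf_digraph (with_proj E)"
      using pair_graphI_complete by (simp add: E_def wf_digraph_def)
    then have "subgraph (with_proj E) (with_proj G)"
      using G.wf_digraph by (simp add: subgraph_def E_def compatibleI_with_proj)
    ultimately show ?thesis by (auto simp: A_def)
  qed
  moreover have "finite A"
    using le by (meson finite_nat_set_iff_bounded_le)
  ultimately have "Max A \<in> A" by (intro Max_in) auto
  then show ?thesis
    using le by (simp add: clique_number_def A_def)
qed

text \<open>
  The property of the levels of a clique: for every \<open>i\<close> in \<open>A\<close>, the numbers \<open>a - i - 1\<close> for the larger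
  \<open>a\<close> in \<open>A\<close> at least double from one to the next.
\<close>
definition doubling_gaps :: "nat set \<Rightarrow> bool" where
  "doubling_gaps A \<longleftrightarrow> (\<forall>i\<in>A. \<forall>j\<in>A. \<forall>l\<in>A. i < j \<longrightarrow> j < l \<longrightarrow> 2 * j \<le> i + l + 1)"

text \<open>
  The bound \<open>m\<close> acts as a further element at the upper end, which makes the induction on the
  largest element go through.
\<close>
lemma card_doubling:
  fixes A :: "nat set"
  assumes "finite A" "\<And>a b. a \<in> A \<Longrightarrow> b \<in> A \<Longrightarrow> a < b \<Longrightarrow> 2 * a \<le> b"
    and "m > 0" "\<And>a. a \<in> A \<Longrightarrow> 2 * a \<le> m"
  shows "2 ^ card A \<le> 2 * m"
  using assms
proof (induction A arbitrary: m rule: finite_linorder_max_induct)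
  case empty
  then show ?case by simp
next
  case (insert b A)
  have b: "2 * b \<le> m" using insert.prems by blast
  have c: "card (insert b A) = Suc (card A)" using insert.hyps by force
  show ?case
  proof (cases "b = 0")
    case True
    then have "A = {}" using insert.hyps by blast
    then show ?thesis using insert.prems by simp
  next
    case False
    have "2 ^ card A \<le> 2 * b"
    proof (rule insert.IH)
      show "2 * a \<le> b'" if "a \<in> A" "b' \<in> A" "a < b'" for a b'
        using insert.prems(1) that by blast
      show "2 * a \<le> b" if "a \<in> A" for a
        using insert.prems(1) insert.hyps(2) that by blast
    qed (use False in simp)
    then show ?thesis using b c by simp
  qed
qed

text \<open>
  The differences \<open>a - i - 1\<close> to the least element \<open>i\<close> form a doubling sequence below \<open>h\<close>.
\<close>
lemma card_doubling_gaps_interval: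
  assumes "A \<subseteq> {..h}" "doubling_gaps A" "h > 0"
  shows "2 ^ card A \<le> 8 * h"
proof (cases "A = {}")
  case False
  have fin: "finite A" using assms(1) by (rule finite_subset) simp
  define i where "i = Min A"
  have i: "i \<in> A" "\<And>a. a \<in> A \<Longrightarrow> i \<le> a"
    using fin False by (simp_all add: i_def)
  define A' where "A' = (\<lambda>a. a - i - 1) ` (A - {i})"
  have gt: "i < a" if "a \<in> A - {i}" for a
    using i(2)[of a] that by auto
  have "inj_on (\<lambda>a. a - i - 1) (A - {i})"
  proof (rule inj_onI)
    fix a b assume "a \<in> A - {i}" "b \<in> A - {i}" "a - i - 1 = b - i - 1"
    then show "a = b" using gt[of a] gt[of b] by linarith
  qed
  then have "card A' = card (A - {i})"
    unfolding A'_def by (rule card_image)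
  then have card: "card A = Suc (card A')"
    using card_Suc_Diff1[OF fin i(1)] by simp
  have "2 ^ card A' \<le> 2 * (2 * h)"
  proof (rule card_doubling)
    show "finite A'" using fin by (simp add: A'_def)
    show "2 * a \<le> b" if ab: "a \<in> A'" "b \<in> A'" "a < b" for a b
    proof -
      obtain j l where "a = j - i - 1" "b = l - i - 1" "j \<in> A - {i}" "l \<in> A - {i}"
        using ab unfolding A'_def by blast
      moreover from this ab(3) have "j < l" by linarith
      ultimately have "2 * j \<le> i + l + 1"
        using assms(2) i(1) gt[of j] unfolding doubling_gaps_def by blast
      then show ?thesis
        using \<open>a = _\<close> \<open>b = _\<close> gt[OF \<open>j \<in> A - {i}\<close>] by linarith
    qed
    show "2 * a \<le> 2 * h" if "a \<in> A'" for a
      using that assms(1) unfolding A'_def by (auto simp: le_diff_conv)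
  qed (use assms(3) in simp)
  then show ?thesis using card by simp
qed (use assms(3) in simp)

text \<open>
  For \<open>i = 2 ^ s - 2 ^ t\<close>, \<open>j = 2 ^ s - 2 ^ u\<close> and \<open>l = 2 ^ s - 2 ^ v\<close> with \<open>t > u > v\<close> the condition
  \<open>2 * j \<le> i + l + 1\<close> says \<open>2 ^ t + 2 ^ v \<le> 2 * 2 ^ u + 1\<close>. As \<open>2 * 2 ^ u \<le> 2 ^ t\<close>, this leaves only \<open>v = 0\<close>. So
  an element above the two least ones must be \<open>2 ^ s - 1\<close>.
\<close>
lemma card_doubling_gaps_reversed_powers:
  assumes "A \<subseteq> (\<lambda>t. 2 ^ s - 2 ^ t) ` {..s}" "doubling_gaps A"
  shows "card A \<le> 3"
proof (cases "\<exists>i j. i \<in> A \<and> j \<in> A \<and> i < j")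
  case False
  have "card A \<le> 1"
    using False by (metis card.infinite card_le_Suc0_iff_eq linorder_neqE_nat One_nat_def zero_le_one)
  then show ?thesis by simp
next
  case True
  have fin: "finite A" using assms(1) by (rule finite_subset) simp
  define i where "i = Min A"
  define j where "j = Min (A - {i})"
  have i: "i \<in> A" "\<And>a. a \<in> A \<Longrightarrow> i \<le> a"
    unfolding i_def using fin True by (blast intro: Min_in, simp)
  have "A - {i} \<noteq> {}"
    using True i(1) by auto
  then have j: "j \<in> A - {i}" "\<And>a. a \<in> A - {i} \<Longrightarrow> j \<le> a"
    unfolding j_def using fin Min_in[of "A - {i}"] Min_le[of "A - {i}"] by blast+
  have "l = 2 ^ s - 1" if l: "l \<in> A" "l \<noteq> i" "l \<noteq> j" for l
  proof -
    have "i < j" "j < l"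
      using i(2)[of j] j(1) j(2)[of l] l by force+
    then have g: "2 * j \<le> i + l + 1"
      using assms(2) i(1) j(1) l(1) unfolding doubling_gaps_def by blast
    have pow: "\<exists>t\<le>s. a = 2 ^ s - 2 ^ t" if "a \<in> A" for a
      using assms(1) that by blast
    obtain t u v where tuv: "i = 2 ^ s - 2 ^ t" "j = 2 ^ s - 2 ^ u" "l = 2 ^ s - 2 ^ v"
      "t \<le> s" "u \<le> s" "v \<le> s"
      using pow[OF i(1)] pow[of j] pow[OF l(1)] j(1) by blast
    have pows: "(2::nat) ^ t \<le> 2 ^ s" "(2::nat) ^ u \<le> 2 ^ s" "(2::nat) ^ v \<le> 2 ^ s"
      using tuv by (simp_all add: power_increasing)
    have "(2::nat) ^ u < 2 ^ t"
      using \<open>i < j\<close> tuv pows by linarith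
    then have "Suc u \<le> t" by (simp add: Suc_leI)
    then have "(2::nat) ^ Suc u \<le> 2 ^ t" by (rule power_increasing) simp
    then have "(2::nat) ^ v \<le> 1"
    proof -
      have "i + 2 ^ t = 2 ^ s" "j + 2 ^ u = 2 ^ s" "l + 2 ^ v = 2 ^ s"
        using tuv pows by simp_all
      then show ?thesis using g \<open>2 ^ Suc u \<le> 2 ^ t\<close> by simp
    qed
    then show ?thesis using tuv(3) by (simp add: le_Suc_eq)
  qed
  then have "A \<subseteq> {i, j, 2 ^ s - 1}" by blast
  then have "card A \<le> card {i, j, 2 ^ s - 1}" by (intro card_mono) auto
  also have "\<dots> \<le> 3" by (simp add: card_insert_if)
  finally show ?thesis .
qed

context level_set
begin

text \<open>
  The abscissae of \<open>y\<close> and \<open>z\<close> are different multiples of \<open>4 ^ level y\<close>, so they differ by at least this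
  number. But both are close to \<open>x\<close>, so they differ by at most
  \<open>2 * 2 ^ (i + j) + 2 * 2 ^ (i + l) \<le> 3 * 2 ^ (i + l)\<close>, where \<open>i\<close>, \<open>j\<close> and \<open>l\<close> are the levels of \<open>x\<close>, \<open>y\<close> and \<open>z\<close>.
\<close>
lemma three_levels:
  assumes x: "x \<in> points L" and y: "y \<in> points L" and z: "z \<in> points L"
    and lev: "level x < level y" "level y < level z" and close: "close x y" "close x z"
  shows "2 * level y \<le> level x + level z + 1"
proof -
  define i j l where "i = level x" "j = level y" "l = level z"
  note ijl = this
  have "4 ^ j dvd y" "4 ^ j dvd z"
    using pow4_level_dvd[OF y] pow4_level_dvd[OF z] lev
      dvd_trans[OF le_imp_power_dvd[of j l "4::nat"]] unfolding ijl by simp_all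
  then have "(4::int) ^ j dvd int y - int z"
    by (metis dvd_diff of_nat_dvd_iff of_nat_power of_nat_numeral)
  moreover have "int y - int z \<noteq> 0" using lev by auto
  ultimately have "\<bar>(4::int) ^ j\<bar> \<le> \<bar>int y - int z\<bar>"
    using dvd_imp_le_int by blast
  also have "\<dots> \<le> \<bar>int x - int y\<bar> + \<bar>int x - int z\<bar>" by linarith
  also have "\<dots> \<le> 2 * 2 ^ (i + j) + 2 * 2 ^ (i + l)"
    using close unfolding close_def ijl by linarith
  also have "(2::int) * 2 ^ (i + j) = 2 ^ (Suc (i + j))" by simp
  also have "(2::int) ^ (Suc (i + j)) \<le> 2 ^ (i + l)"
    using lev ijl by (intro power_increasing) auto
  also have "(2::int) ^ (i + l) + 2 * 2 ^ (i + l) < 2 ^ (i + l + 2)" by simp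
  finally have "(2::int) ^ (2 * j) < 2 ^ (i + l + 2)"
    by (simp add: power_mult)
  then have "2 * j < i + l + 2" by (simp only: power_strict_increasing_iff)
  then show ?thesis by (simp add: ijl)
qed

text \<open>
  On one level only consecutive points are adjacent.
\<close>
lemma card_clique_level_le:
  assumes Q: "Q \<subseteq> points L" and close: "\<And>x y. x \<in> Q \<Longrightarrow> y \<in> Q \<Longrightarrow> x \<noteq> y \<Longrightarrow> close x y"
  shows "card {x \<in> Q. level x = j} \<le> 2"
proof (cases "{x \<in> Q. level x = j} = {}")
  case False
  define A where "A = {x \<in> Q. level x = j}"
  define a where "a = Min A"
  have "finite A" using finite_subset[OF Q finite_points] by (simp add: A_def)
  then have a: "a \<in> A" "\<And>x. x \<in> A \<Longrightarrow> a \<le> x"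
    using False by (simp_all add: a_def A_def[symmetric])
  have "x \<in> {a, a + 2 * 4 ^ j}" if x: "x \<in> A" for x
  proof (cases "x = a")
    case False
    have "\<exists>m. y = point j m" if "y \<in> A" for y
      using that Q unfolding A_def by (auto elim!: pointsE dest!: subsetD)
    then obtain m n where m: "a = point j m" and n: "x = point j n"
      using a(1) x by blast
    have "close a x" using close a(1) x False unfolding A_def by blast
    then have "int x - int a \<le> 2 * 2 ^ (j + j)"
      using m n by (simp add: close_def)
    moreover have "(2::int) ^ (j + j) = 4 ^ j" by (simp add: power_add flip: power_mult_distrib)
    ultimately have "int x \<le> int (a + 2 * 4 ^ j)" by simp
    then have "x \<le> a + 2 * 4 ^ j" by (simp only: of_nat_le_iff)
    then have "4 ^ j * (2 * n + 1) \<le> 4 ^ j * (2 * (m + 1) + 1)"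
      by (simp add: m n point_def)
    then have "2 * n + 1 \<le> 2 * (m + 1) + 1"
      by (subst (asm) mult_le_cancel1) simp
    then have "n \<le> m + 1" by simp
    moreover have "m < n"
      using a(2)[OF x] False by (auto simp: m n point_def)
    ultimately have "n = m + 1" by simp
    then show ?thesis by (simp add: m n point_def)
  qed simp
  then have "card A \<le> card {a, a + 2 * 4 ^ j}" by (intro card_mono) auto
  also have "\<dots> \<le> 2" by (simp add: card_insert_if)
  finally show ?thesis by (simp add: A_def)
next
  case True
  then show ?thesis by (simp only: card.empty)
qed

lemma clique_number_level_graph_le:
  assumes "\<And>A. A \<subseteq> L \<Longrightarrow> doubling_gaps A \<Longrightarrow> card A \<le> b"
  shows "clique_number (level_graph L) \<le> 2 * b"
proof (rule clique_number_le[OF pair_graph_level_graph])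
  fix Q assume "Q \<subseteq> pverts (level_graph L)"
    and clique: "\<And>x y. x \<in> Q \<Longrightarrow> y \<in> Q \<Longrightarrow> x \<noteq> y \<Longrightarrow> (x, y) \<in> parcs (level_graph L)"
  then have Q: "Q \<subseteq> points L" and close: "\<And>x y. x \<in> Q \<Longrightarrow> y \<in> Q \<Longrightarrow> x \<noteq> y \<Longrightarrow> close x y"
    by (auto simp: arc_level_graph_iff)
  have fin: "finite Q" using Q finite_points by (rule finite_subset)
  have "level ` Q \<subseteq> L" using Q by (auto elim: pointsE)
  moreover have "doubling_gaps (level ` Q)"
    unfolding doubling_gaps_def
  proof (intro ballI impI)
    fix i j l assume "i \<in> level ` Q" "j \<in> level ` Q" "l \<in> level ` Q" and lt: "i < j" "j < l"
    then obtain x y z where xyz: "x \<in> Q" "y \<in> Q" "z \<in> Q" "i = level x" "j = level y" "l = level z"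
      by blast
    show "2 * j \<le> i + l + 1"
      unfolding xyz(4-6)
    proof (rule three_levels)
      show "close x y" "close x z" using close xyz lt by fastforce+
    qed (use xyz lt Q in auto)
  qed
  ultimately have b: "card (level ` Q) \<le> b" by (rule assms)
  have "card Q \<le> card (\<Union>j\<in>level ` Q. {x \<in> Q. level x = j})"
    using fin by (intro card_mono) auto
  also have "\<dots> \<le> (\<Sum>j\<in>level ` Q. card {x \<in> Q. level x = j})"
    using fin by (intro card_UN_le) auto
  also have "\<dots> \<le> (\<Sum>j\<in>level ` Q. 2)"
    using Q close by (intro sum_mono card_clique_level_le)
  also have "\<dots> \<le> 2 * b" using b by simp
  finally show "card Q \<le> 2 * b" .
qed

section \<open>Rows and columns\<close>

text \<open>
  Consecutive points of level \<open>j\<close> have distance \<open>2 * 4 ^ j\<close>, exactly the threshold, so a run of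
  consecutive points is a path.
\<close>
lemma walk_connected_segment:
  assumes "j \<in> L" "b \<le> k * 4 ^ (h - j)"
  shows "walk_connected (parcs (level_graph L)) (point j ` {a..<b})"
proof (cases "a < b")
  case True
  let ?S = "point j ` {a..<b}" and ?E = "parcs (level_graph L)"
  interpret G: pair_graph "level_graph L" by (rule pair_graph_level_graph)
  have arc: "(point j (Suc m), point j m) \<in> ?E" if "Suc m < b" for m
  proof -
    have "point j (Suc m) \<in> points L" "point j m \<in> points L"
      using that assms by (auto intro!: pointI)
    moreover have "(2::int) ^ (j + j) = 4 ^ j" by (simp add: power_add flip: power_mult_distrib)
    then have "close (point j (Suc m)) (point j m)"
      by (simp add: close_def) (simp add: point_def algebra_simps)
    ultimately show ?thesis by (simp add: arc_level_graph_iff point_def)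
  qed
  have "(point j m, point j a) \<in> rtrancl_on ?S ?E" if "a \<le> m" "m < b" for m
    using that
  proof (induction m rule: dec_induct)
    case base
    then show ?case by simp
  next
    case (step m)
    then show ?case using arc[of m] by (auto intro: converse_rtrancl_on_into_rtrancl_on)
  qed
  moreover have "sym ?E" using G.arcs_symmetric by (blast intro: symI)
  ultimately show ?thesis
    using True by (intro walk_connected_star[of _ "point j a"]) auto
qed (simp add: walk_connected_def)

definition row :: "nat \<Rightarrow> nat set" where
  "row j = {x \<in> points L. level x = j}"

definition column :: "nat \<Rightarrow> nat set" where
  "column c = {x \<in> points L. 2 * 4 ^ h * c \<le> x \<and> x < 2 * 4 ^ h * (c + 1)}"

lemma row_eq: "j \<in> L \<Longrightarrow> row j = point j ` {0..<k * 4 ^ (h - j)}"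
  by (force simp: row_def elim: pointsE intro: pointI)

text \<open>
  The boundaries of the columns are even multiples of \<open>4 ^ j\<close> for every level \<open>j\<close>, so no odd multiple
  lies on them and a column contains \<open>4 ^ (h - j)\<close> consecutive points of level \<open>j\<close>.
\<close>
lemma point_in_column_iff:
  assumes "j \<in> L" "m < k * 4 ^ (h - j)"
  shows "point j m \<in> column c \<longleftrightarrow> m \<in> {4 ^ (h - j) * c..<4 ^ (h - j) * (c + 1)}"
proof -
  have "2 * 4 ^ h * d = 4 ^ j * (2 * (4 ^ (h - j) * d))" for d :: nat
    by (simp flip: pow4_split[OF assms(1)])
  moreover have "point j m \<in> points L" using assms by (rule pointI)
  ultimately have "point j m \<in> column c \<longleftrightarrow> 4 ^ j * (2 * (4 ^ (h - j) * c)) \<le> 4 ^ j * (2 * m + 1) \<and>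
      4 ^ j * (2 * m + 1) < 4 ^ j * (2 * (4 ^ (h - j) * (c + 1)))"
    by (simp only: column_def mem_Collect_eq point_def) simp
  also have "\<dots> \<longleftrightarrow> 2 * (4 ^ (h - j) * c) \<le> 2 * m + 1 \<and> 2 * m + 1 < 2 * (4 ^ (h - j) * (c + 1))"
    by (simp only: mult_le_cancel1 mult_less_cancel1) simp
  also have "\<dots> \<longleftrightarrow> m \<in> {4 ^ (h - j) * c..<4 ^ (h - j) * (c + 1)}"
    unfolding atLeastLessThan_iff by linarith
  finally show ?thesis .
qed

lemma column_index_le:
  assumes "c < k" shows "4 ^ (h - j) * (c + 1) \<le> k * 4 ^ (h - j)"
  using assms mult_le_mono2[of "c + 1" k "4 ^ (h - j)"] by (simp add: mult.commute[of k])

lemma row_Int_column: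
  assumes "j \<in> L" "c < k"
  shows "row j \<inter> column c = point j ` {4 ^ (h - j) * c..<4 ^ (h - j) * (c + 1)}"
  using assms column_index_le[OF assms(2), of j] point_in_column_iff[OF assms(1)]
  unfolding row_eq[OF assms(1)] by fastforce

text \<open>
  The only point \<open>t\<close> of the column on the top level lies in its middle. On each lower level \<open>j\<close>
  the point \<open>t - 4 ^ j\<close> is adjacent to \<open>t\<close>, and it belongs to the run of points of level \<open>j\<close> in the column.
\<close>
lemma walk_connected_column:
  assumes c: "c < k"
  shows "walk_connected (parcs (level_graph L)) (column c)"
proof -
  let ?E = "parcs (level_graph L)"
  interpret G: pair_graph "level_graph L" by (rule pair_graph_level_graph)
  define t where "t = point h c"
  have t: "t \<in> row h \<inter> column c"
    unfolding t_def row_Int_column[OF Max_level c] by simp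
  have "(x, t) \<in> rtrancl_on (column c) ?E" if x: "x \<in> column c" for x
  proof -
    define j where "j = level x"
    have j: "j \<in> L" "x \<in> row j \<inter> column c"
      using x by (auto simp: row_def column_def j_def elim: pointsE)
    show ?thesis
    proof (cases "j = h")
      case True
      then have "x = t"
        using j(2) unfolding row_Int_column[OF j(1) c] by (simp add: t_def)
      then show ?thesis using x by simp
    next
      case False
      then have "j < h" using level_le_Max[OF j(1)] by simp
      then obtain e where e: "h - j = Suc e" by (metis Suc_diff_Suc)
      (* The index of t - 4 ^ j on level j: half of the run precedes it, up to one. *)
      define m where "m = 4 ^ (h - j) * c + 2 * 4 ^ e - 1"
      have m: "m \<in> {4 ^ (h - j) * c..<4 ^ (h - j) * (c + 1)}"
      proof -
        have "(4::nat) ^ e > 0" by simp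
        then show ?thesis unfolding m_def e atLeastLessThan_iff power_Suc distrib_left by linarith
      qed
      have "m + 1 = 4 ^ (h - j) * c + 2 * 4 ^ e"
        unfolding m_def by simp
      then have "2 * m + 1 + 1 = 4 ^ (h - j) * (2 * c + 1)"
        by (simp add: e algebra_simps)
      then have "4 ^ j * (2 * m + 1) + 4 ^ j = 4 ^ j * 4 ^ (h - j) * (2 * c + 1)"
        by (metis mult.assoc mult.right_neutral distrib_left)
      then have eq: "point j m + 4 ^ j = t"
        unfolding pow4_split[OF j(1)] by (simp add: point_def t_def)
      have p: "point j m \<in> row j \<inter> column c"
        using m unfolding row_Int_column[OF j(1) c] by simp
      have "(4::int) ^ j \<le> 2 * 2 ^ (j + h)"
      proof -
        have "(4::int) ^ j = 2 ^ (j + j)" by (simp add: power_add flip: power_mult_distrib)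
        also have "\<dots> \<le> 2 ^ (j + h)" using \<open>j < h\<close> by (intro power_increasing) auto
        also have "(2::int) ^ (j + h) \<le> 2 * 2 ^ (j + h)" by simp
        finally show ?thesis .
      qed
      then have "close (point j m) t"
        unfolding close_def by (simp add: t_def[symmetric] flip: eq) (simp add: eq t_def)
      moreover have "point j m \<noteq> t" using eq by auto
      ultimately have arc: "(point j m, t) \<in> ?E"
        using p t by (simp add: arc_level_graph_iff row_def)
      have "walk_connected ?E (row j \<inter> column c)"
        unfolding row_Int_column[OF j(1) c]
        using j(1) column_index_le[OF c] by (rule walk_connected_segment)
      then have "(x, point j m) \<in> rtrancl_on (row j \<inter> column c) ?E"
        using j(2) p by (rule walk_connectedD)
      then have "(x, point j m) \<in> rtrancl_on (column c) ?E"
        by (rule rtrancl_on_mono[OF subset_refl Int_lower2])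
      then show ?thesis using arc t by (auto intro: rtrancl_on_into_rtrancl_on)
    qed
  qed
  moreover have "sym ?E" using G.arcs_symmetric by (blast intro: symI)
  ultimately show ?thesis using t by (blast intro: walk_connected_star)
qed

lemma treewidth_level_graph_ge: "k \<le> treewidth (level_graph L) + 1"
proof (rule treewidth_ge_crossing[OF pair_graph_level_graph])
  show "row j \<subseteq> pverts (level_graph L)" "column c \<subseteq> pverts (level_graph L)" for j c
    by (auto simp: row_def column_def)
  show "walk_connected (parcs (level_graph L)) (row j)" if "j \<in> L" for j
    unfolding row_eq[OF that] using that by (intro walk_connected_segment) auto
  show "disjoint_family_on row L"
    by (auto simp: disjoint_family_on_def row_def)
  show "walk_connected (parcs (level_graph L)) (column c)" if "c \<in> {..<k}" for c
    using that by (intro walk_connected_column) auto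
  show "disjoint_family_on column {..<k}"
  proof (unfold disjoint_family_on_def, intro ballI impI)
    have "column c \<inter> column d = {}" if "c < d" for c d
    proof -
      have "2 * 4 ^ h * (c + 1) \<le> 2 * 4 ^ h * d" using that by (intro mult_left_mono) auto
      then show ?thesis by (force simp: column_def)
    qed
    then show "column c \<inter> column d = {}" if "c \<noteq> d" for c d
      using that by (metis Int_commute linorder_neqE_nat)
  qed
  show "row j \<inter> column c \<noteq> {}" if "j \<in> L" "c \<in> {..<k}" for j c
    using that by (simp add: row_Int_column)
qed auto

section \<open>Number of vertices and disk radius\<close>

lemma k_le: "k \<le> h + 1"
proof -
  have "L \<subseteq> {..h}" using level_le_Max by auto
  then have "k \<le> card {..h}" by (intro card_mono) auto
  then show ?thesis by simp
qed

lemma card_points_ge: "4 ^ h \<le> card (points L)"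
proof -
  have "4 ^ h \<le> k * 4 ^ h" using k_pos by simp
  then show ?thesis using card_points(1) by linarith
qed

text \<open>
  The number of vertices lies between \<open>4 ^ h\<close> and \<open>2 * (h + 1) * 4 ^ h \<le> 32 ^ h\<close>.
\<close>
lemma ln_card_points:
  assumes h: "h \<ge> 1"
  shows "real h \<le> ln (card (points L))" "ln (card (points L)) \<le> 5 * real h"
proof -
  define n where "n = card (points L)"
  have n: "4 ^ h \<le> n" using card_points_ge by (simp add: n_def)
  have pos: "n > 0" using n by (rule order.strict_trans2[rotated]) simp
  have "k \<le> 4 ^ h"
  proof -
    have "m + 1 \<le> 4 ^ m" for m :: nat by (induction m) auto
    then show ?thesis using k_le le_trans by blast
  qed
  moreover have "2 \<le> (2::nat) ^ h"
    using power_increasing[OF h, of "2::nat"] by simp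
  ultimately have "2 * (k * 4 ^ h) \<le> 2 ^ h * (4 ^ h * 4 ^ h)"
    by (intro mult_mono) auto
  also have "\<dots> = 32 ^ h" by (simp flip: power_mult_distrib)
  finally have "n \<le> 32 ^ h"
    using card_points(2) by (simp add: n_def)
  then have "real n \<le> 32 ^ h"
    by (metis of_nat_le_iff of_nat_numeral of_nat_power)
  then have "ln n \<le> ln (32 ^ h)"
    using pos by simp
  also have "\<dots> = real h * (5 * ln 2)"
    using ln_realpow[of "2::real" 5] by (simp add: ln_realpow)
  also have "\<dots> \<le> real h * 5"
    using ln_2_less_1 by (intro mult_left_mono) auto
  finally show "ln (card (points L)) \<le> 5 * real h"
    by (simp add: n_def)
  have "real h * 1 \<le> real h * ln 4"
  proof (intro mult_left_mono)
    have "exp 1 \<le> (4::real)" using exp_le by linarith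
    then show "1 \<le> ln (4::real)" by (simp add: ln_ge_iff)
  qed simp
  also have "\<dots> = ln (4 ^ h)" by (simp add: ln_realpow)
  also have "\<dots> \<le> ln n"
  proof -
    have "(4::real) ^ h \<le> real n"
      using n by (metis of_nat_le_iff of_nat_numeral of_nat_power)
    then show ?thesis using pos by (subst ln_le_cancel_iff) auto
  qed
  finally show "real h \<le> ln (card (points L))"
    by (simp add: n_def)
qed

text \<open>
  Let \<open>N = card L * 4 ^ h\<close>. The number \<open>n\<close> of vertices is between \<open>N\<close> and \<open>2 * N\<close>, and
  \<open>arsinh N = ln (N + sqrt (N\<^sup>2 + 1))\<close> is between \<open>ln (2 * N)\<close> and \<open>ln (3 * N) \<le> ln (n\<^sup>2)\<close>.
\<close>
lemma disk_radius_bounds: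
  assumes h: "h \<ge> 1"
  shows "ln (card (points L)) \<le> arsinh (real (k * 4 ^ h))"
    and "arsinh (real (k * 4 ^ h)) \<le> 2 * ln (card (points L))"
proof -
  define N where "N = real (k * 4 ^ h)"
  define n where "n = real (card (points L))"
  have "(4::nat) \<le> 4 ^ h" using power_increasing[OF h, of "4::nat"] by simp
  also have "\<dots> \<le> k * 4 ^ h" using k_pos by simp
  finally have N: "4 \<le> N" unfolding N_def by linarith
  have n: "N \<le> n" "n \<le> 2 * N"
    using of_nat_mono[OF card_points(1), where 'a = real] of_nat_mono[OF card_points(2), where 'a = real]
    unfolding N_def n_def by simp_all
  have s: "N \<le> sqrt (N\<^sup>2 + 1)" by (rule real_le_rsqrt) simp
  have "N\<^sup>2 \<ge> 4\<^sup>2" using N by (intro power_mono) auto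
  then have s2: "sqrt (N\<^sup>2 + 1) \<le> 2 * N"
    using N by (intro real_le_lsqrt) (auto simp: power_mult_distrib)
  have ar: "arsinh N = ln (N + sqrt (N\<^sup>2 + 1))" by (rule arsinh_real_def)
  have "ln n \<le> arsinh N"
    unfolding ar using n N s by simp
  then show "ln (card (points L)) \<le> arsinh (real (k * 4 ^ h))"
    by (simp add: n_def N_def)
  have "N + sqrt (N\<^sup>2 + 1) \<le> 3 * n" using n s2 by linarith
  also have "\<dots> \<le> n * n" using n N by (intro mult_right_mono) auto
  finally have "arsinh N \<le> ln (n * n)"
    unfolding ar using n N s by simp
  also have "\<dots> = 2 * ln n" using n N by (simp add: ln_mult)
  finally show "arsinh (real (k * 4 ^ h)) \<le> 2 * ln (card (points L))"
    by (simp add: n_def N_def)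
qed

end

section \<open>The two families\<close>

lemma level_graph_family:
  assumes "\<And>s. level_set (M s)" and large: "\<And>s. s < Max (M s)"
  defines "\<G> \<equiv> range (\<lambda>s. level_graph (M s))"
  shows "shudg_family \<G>" "disk_radius_bigtheta \<G> (\<lambda>n. ln (real n))"
proof -
  have size: "s \<le> card (points (M s))" for s
  proof -
    interpret level_set "M s" by fact
    have "s + 1 \<le> 4 ^ s" by (induction s) auto
    then have "s \<le> 4 ^ s" by simp
    also have "(4::nat) ^ s \<le> 4 ^ Max (M s)"
      using large[of s] by (intro power_increasing) auto
    finally show ?thesis using card_points_ge by linarith
  qed
  show "shudg_family \<G>"
    unfolding shudg_family_def \<G>_def
    using level_set.shudg_level_graph[OF assms(1)] size by fastforce
  have "\<exists>r. 1 * ln (card (pverts G)) \<le> r \<and> r \<le> 2 * ln (card (pverts G)) \<and> shudg r G"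
    if memb: "G \<in> \<G>" for G
  proof -
    obtain s where G: "G = level_graph (M s)" using memb by (auto simp: \<G>_def)
    interpret level_set "M s" by fact
    have "1 \<le> h" using large[of s] by simp
    then show ?thesis
      using disk_radius_bounds shudg_level_graph unfolding G by fastforce
  qed
  then show "disk_radius_bigtheta \<G> (\<lambda>n. ln (real n))"
    unfolding disk_radius_bigtheta_def eventually_order_at_top
    by (intro exI[of _ 1] exI[of _ 2] conjI) auto
qed

lemma eventually_order_at_topI:
  "(\<And>G. G \<in> \<G> \<Longrightarrow> P G) \<Longrightarrow> eventually P (order_at_top \<G>)"
  by (auto simp: eventually_order_at_top)

lemma level_set_interval: "level_set {..h}"
  by unfold_locales auto

lemma level_set_reversed_powers: "level_set ((\<lambda>t. 2 ^ s - 2 ^ t) ` {..s})"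
  by unfold_locales force+

lemma inj_on_reversed_powers: "inj_on (\<lambda>t. 2 ^ s - 2 ^ t :: nat) {..s}"
proof (rule inj_onI)
  fix t u assume "t \<in> {..s}" "u \<in> {..s}" and eq: "(2::nat) ^ s - 2 ^ t = 2 ^ s - 2 ^ u"
  then have "(2::nat) ^ t \<le> 2 ^ s" "(2::nat) ^ u \<le> 2 ^ s" by (simp_all add: power_increasing)
  with eq have "(2::nat) ^ t = 2 ^ u" by linarith
  then show "t = u" by simp
qed

lemma Max_reversed_powers: "Max ((\<lambda>t. 2 ^ s - 2 ^ t) ` {..s}) = (2 ^ s - 1 :: nat)"
proof (rule Max_eqI)
  show "2 ^ s - 1 \<in> (\<lambda>t. 2 ^ s - 2 ^ t :: nat) ` {..s}"
    by (rule image_eqI[of _ _ 0]) auto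
  show "a \<le> 2 ^ s - 1" if "a \<in> (\<lambda>t. 2 ^ s - 2 ^ t :: nat) ` {..s}" for a
    using that by (auto intro: diff_le_mono2)
qed simp

text \<open>
  The shift by \<open>2\<close> keeps \<open>ln h\<close> away from \<open>0\<close>, so that it absorbs the constant in
  \<open>log 2 (8 * h) = 3 + log 2 h\<close>.
\<close>
lemma interval_family:
  defines "\<G> \<equiv> range (\<lambda>s. level_graph {..s + 2})"
  shows "shudg_family \<G>" "disk_radius_bigtheta \<G> (\<lambda>n. ln (real n))"
    and "(\<lambda>G. real (clique_number G)) \<in> O[order_at_top \<G>](\<lambda>G. ln (ln (real (card (pverts G)))))"
    and "(\<lambda>G. real (treewidth G)) \<in> \<Omega>[order_at_top \<G>](\<lambda>G. ln (real (card (pverts G))))"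
proof -
  have max: "Max {..n} = n" for n :: nat
    by (rule Max_eqI) auto
  have ls: "level_set {..s + 2}" for s
    by (rule level_set_interval)
  show "shudg_family \<G>" "disk_radius_bigtheta \<G> (\<lambda>n. ln (real n))"
    unfolding \<G>_def using level_graph_family[of "\<lambda>s. {..s + 2}"] ls by (simp_all add: max)
  have "real (clique_number G) \<le> 8 / ln 2 * \<bar>ln (ln (real (card (pverts G))))\<bar>"
    and "\<bar>ln (real (card (pverts G)))\<bar> \<le> 5 * real (treewidth G)" if memb: "G \<in> \<G>" for G
  proof -
    obtain s where G: "G = level_graph {..s + 2}" using memb by (auto simp: \<G>_def)
    interpret level_set "{..s + 2}" by (rule ls)
    define H where "H = s + 2"
    have h: "h = H" by (simp add: max H_def)
    have H: "H \<ge> 2" by (simp add: H_def)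
    have n: "real H \<le> ln (card (pverts G))" "ln (card (pverts G)) \<le> 5 * real H"
      using ln_card_points H unfolding h by (simp_all add: G)
    have "clique_number G \<le> 2 * nat \<lfloor>log 2 (8 * real H)\<rfloor>"
      unfolding G
    proof (rule clique_number_level_graph_le)
      fix A assume "A \<subseteq> {..s + 2}" "doubling_gaps A"
      then have "2 ^ card A \<le> 8 * H"
        using H unfolding H_def by (intro card_doubling_gaps_interval) auto
      then have "real (2 ^ card A) \<le> real (8 * H)" by (simp only: of_nat_le_iff)
      then have "real (card A) \<le> log 2 (8 * real H)"
        using H by (intro le_log_of_power) auto
      then show "card A \<le> nat \<lfloor>log 2 (8 * real H)\<rfloor>" by (rule le_nat_floor)
    qed
    then have "real (clique_number G) \<le> 2 * real (nat \<lfloor>log 2 (8 * real H)\<rfloor>)" by linarith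
    also have "\<dots> \<le> 2 * log 2 (8 * real H)"
      using H by (intro mult_left_mono of_nat_floor) auto
    also have "log 2 (8 * real H) = 3 + log 2 (real H)"
    proof -
      have "log 2 (8::real) = 3" using log_pow_cancel[of "2::real" 3] by simp
      then show ?thesis using H by (simp add: log_mult)
    qed
    also have "2 * (3 + log 2 (real H)) \<le> 8 * log 2 (real H)"
      using H by simp
    also have "\<dots> = 8 / ln 2 * ln (real H)" by (simp add: log_def)
    also have "\<dots> \<le> 8 / ln 2 * \<bar>ln (ln (real (card (pverts G))))\<bar>"
    proof (intro mult_left_mono)
      have "ln (real H) \<le> ln (ln (real (card (pverts G))))"
        using n(1) H by simp
      then show "ln (real H) \<le> \<bar>ln (ln (real (card (pverts G))))\<bar>" by linarith
    qed simp
    finally show "real (clique_number G) \<le> 8 / ln 2 * \<bar>ln (ln (real (card (pverts G))))\<bar>" .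
    have "H \<le> treewidth G"
      using treewidth_level_graph_ge unfolding G by (simp add: H_def)
    then show "\<bar>ln (real (card (pverts G)))\<bar> \<le> 5 * real (treewidth G)"
      using n by linarith
  qed
  then have "\<forall>\<^sub>F G in order_at_top \<G>.
      norm (real (clique_number G)) \<le> 8 / ln 2 * norm (ln (ln (real (card (pverts G)))))"
    and "\<forall>\<^sub>F G in order_at_top \<G>. norm (ln (real (card (pverts G)))) \<le> 5 * norm (real (treewidth G))"
    by (simp_all add: eventually_order_at_topI)
  then show "(\<lambda>G. real (clique_number G)) \<in> O[order_at_top \<G>](\<lambda>G. ln (ln (real (card (pverts G)))))"
    and "(\<lambda>G. real (treewidth G)) \<in> \<Omega>[order_at_top \<G>](\<lambda>G. ln (real (card (pverts G))))"
    unfolding bigomega_iff_bigo by - (rule bigoI, assumption)+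
qed

text \<open>
  Here \<open>ln n\<close> is of order \<open>h = 2 ^ Suc s - 1\<close>, hence \<open>ln (ln n)\<close> is of order \<open>s\<close>, the number of levels,
  while at most three of the levels occur in a clique.
\<close>
lemma reversed_powers_family:
  defines "\<G> \<equiv> range (\<lambda>s. level_graph ((\<lambda>t. 2 ^ Suc s - 2 ^ t) ` {..Suc s}))"
  shows "shudg_family \<G>" "disk_radius_bigtheta \<G> (\<lambda>n. ln (real n))"
    and "(\<lambda>G. real (clique_number G)) \<in> O[order_at_top \<G>](\<lambda>G. 1 :: real)"
    and "(\<lambda>G. real (treewidth G)) \<in> \<Omega>[order_at_top \<G>](\<lambda>G. ln (ln (real (card (pverts G)))))"
proof -
  define M where "M s = (\<lambda>t. 2 ^ Suc s - 2 ^ t :: nat) ` {..Suc s}" for s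
  have ls: "level_set (M s)" for s
    unfolding M_def by (rule level_set_reversed_powers)
  have max: "Max (M s) = 2 ^ Suc s - 1" for s
    unfolding M_def by (rule Max_reversed_powers)
  have large: "s < Max (M s)" for s
    using less_exp[of "Suc s"] unfolding max by linarith
  have \<G>: "\<G> = range (\<lambda>s. level_graph (M s))"
    by (simp add: \<G>_def M_def)
  show "shudg_family \<G>" "disk_radius_bigtheta \<G> (\<lambda>n. ln (real n))"
    unfolding \<G> using level_graph_family[of M] ls large by blast+
  have "clique_number G \<le> 6"
    and "\<bar>ln (ln (real (card (pverts G))))\<bar> \<le> 6 * real (treewidth G)" if memb: "G \<in> \<G>" for G
  proof -
    obtain s where G: "G = level_graph (M s)" using memb by (auto simp: \<G>)
    interpret level_set "M s" by (rule ls)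
    have "clique_number (level_graph (M s)) \<le> 2 * 3"
      unfolding M_def using level_set.clique_number_level_graph_le[OF ls[of s]]
        card_doubling_gaps_reversed_powers[of _ "Suc s"] unfolding M_def by blast
    then show "clique_number G \<le> 6" by (simp add: G)
    have "card (M s) = Suc (Suc s)"
      unfolding M_def by (simp only: card_image[OF inj_on_reversed_powers] card_atMost)
    then have tw: "Suc s \<le> treewidth G"
      using treewidth_level_graph_ge unfolding G by simp
    have h: "1 \<le> h" using large[of s] by simp
    have "real h \<ge> 1" using h by linarith
    then have n: "1 \<le> ln (real (card (pverts G)))"
      using ln_card_points(1)[OF h] unfolding G by simp
    have "h \<le> 2 ^ Suc s" by (simp add: max)
    then have "real h \<le> real (2 ^ Suc s)" by (simp only: of_nat_le_iff)
    then have "ln (real (card (pverts G))) \<le> 5 * 2 ^ Suc s"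
      using ln_card_points(2)[OF h] unfolding G by simp
    then have "ln (ln (real (card (pverts G)))) \<le> ln (5 * 2 ^ Suc s)"
      using n by simp
    also have "\<dots> = ln 5 + real (Suc s) * ln 2"
      by (simp only: ln_mult ln_realpow) (simp add: ln_realpow ln_mult algebra_simps)
    also have "\<dots> \<le> 4 + real (Suc s) * 1"
      using ln_2_less_1 ln_le_minus_one[of "5::real"] by (intro add_mono mult_left_mono) auto
    also have "\<dots> \<le> 6 * real (treewidth G)"
    proof -
      have "real (Suc s) \<le> real (treewidth G)" using tw by (simp only: of_nat_le_iff)
      then show ?thesis by simp
    qed
    finally show "\<bar>ln (ln (real (card (pverts G))))\<bar> \<le> 6 * real (treewidth G)"
      using n by simp
  qed
  then have "\<forall>\<^sub>F G in order_at_top \<G>. norm (real (clique_number G)) \<le> 6 * norm (1 :: real)"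
    and "\<forall>\<^sub>F G in order_at_top \<G>.
      norm (ln (ln (real (card (pverts G))))) \<le> 6 * norm (real (treewidth G))"
    by (simp_all add: eventually_order_at_topI)
  then show "(\<lambda>G. real (clique_number G)) \<in> O[order_at_top \<G>](\<lambda>G. 1 :: real)"
    and "(\<lambda>G. real (treewidth G)) \<in> \<Omega>[order_at_top \<G>](\<lambda>G. ln (ln (real (card (pverts G)))))"
    unfolding bigomega_iff_bigo by - (rule bigoI, assumption)+
qed

theorem theorem4:
  shows
   "(\<exists>\<G> :: nat pair_pre_digraph set.
       shudg_family \<G> \<and>
       disk_radius_bigtheta \<G> (\<lambda>n. ln (real n)) \<and>
       (\<lambda>G. real (clique_number G)) \<in> O[order_at_top \<G>](\<lambda>G. ln (ln (real (card (pverts G))))) \<and>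
       (\<lambda>G. real (treewidth G)) \<in> \<Omega>[order_at_top \<G>](\<lambda>G. ln (real (card (pverts G))))) \<and>
    (\<exists>\<G> :: nat pair_pre_digraph set.
       shudg_family \<G> \<and>
       disk_radius_bigtheta \<G> (\<lambda>n. ln (real n)) \<and>
       (\<lambda>G. real (clique_number G)) \<in> O[order_at_top \<G>](\<lambda>G. 1 :: real) \<and>
       (\<lambda>G. real (treewidth G)) \<in> \<Omega>[order_at_top \<G>](\<lambda>G. ln (ln (real (card (pverts G))))))"
  using interval_family reversed_powers_family by blast

end
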